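(* Let $\mathscr{T}=\{a,b,c\}$ and $I=\{1,2,3\}$, and fix any $x,y,z$ with $\{x,y,z\}=\{a,b,c\}$. Up to isomorphism there are exactly seventeen binomial partial Steiner triple systems on $15$ points (that is, $(15_4\,20_3)$-configurations) that freely contain at least three graphs $K_5$ each. These are the systems of triangle perspectives $\mathrm{TP}(\xi)$ determined by the following triples $(\xi(1,2),\xi(2,3),\xi(1,3))$: $$(\rho,\rho,\rho),\ (\rho,\rho,\mathrm{id}),\ (\rho,\mathrm{id},\mathrm{id}),\ (\rho,\rho,\rho^{-1}),\ (\rho,\rho^{-1},\mathrm{id}),$$ $$(\sigma_x,\sigma_y,\sigma_z),\ (\sigma_x,\sigma_y,\mathrm{id}),\ (\sigma_x,\rho,\mathrm{id}),\ (\sigma_x,\sigma_y,\rho),\ (\sigma_x,\sigma_y,\rho^{-1}),$$ $$(\sigma_x,\sigma_x,\sigma_y),\ (\sigma_x,\sigma_x,\rho),\ (\rho,\rho,\sigma_z),\ (\rho,\rho^{-1},\sigma_z),$$ $$(\sigma_x,\sigma_x,\sigma_x),\ (\mathrm{id},\mathrm{id},\sigma_x),\ (\mathrm{id},\mathrm{id},\mathrm{id}).$$ That is, these seventeen structures are pairwise non-isomorphic $(15_4\,20_3)$-configurations, each freely containing at least three graphs $K_5$, and every $(15_4\,20_3)$-configuration that freely contains at least three graphs $K_5$ is isomorphic to one of them.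
   Context: A $(v_r\,b_k)$-configuration is a finite incidence structure with $v$ points and $b$ lines (regarded as sets of points) such that each point is on exactly $r$ lines, each line has exactly $k$ points, and two distinct points are on at most one common line. A binomial partial Steiner triple system on $15$ points is a $(15_4\,20_3)$-configuration. An isomorphism is a bijection between point sets that maps the set of lines onto the set of lines. For a set $X$ let $\wp_2(X)$ be the set of its $2$-element subsets. A configuration with point set $S$ and line set $\mathcal{L}$ freely contains the complete graph $K_X$ if $X\subset S$, for every edge $e\in\wp_2(X)$ there is a unique line $\overline{e}\in\mathcal{L}$ containing $e$, and any two edges $e_1,e_2\in\wp_2(X)$ with $\overline{e_1}\cap\overline{e_2}\neq\emptyset$ have a common vertex in $X$. It is called a graph $K_5$ when $|X|=5$; containing at least three graphs $K_5$ means that there are at least three such sets $X$. Permutations of $\mathscr{T}=\{a,b,c\}$: $\rho$ is given by $\rho(a)=b$, $\rho(b)=c$, $\rho(c)=a$; for $x\in\mathscr{T}$, $\sigma_x$ is the transposition fixing $x$ and interchanging the other two elements. $S_{\mathscr{T}}$ is the symmetric group on $\mathscr{T}$. Let $I=\{1,2,3\}$ and let $\xi\colon I\times I\to S_{\mathscr{T}}$ satisfy $\xi(i,i)=\mathrm{id}$ and $\xi(j,i)=\xi(i,j)^{-1}$ for all $i,j\in I$ (so $\xi$ is determined by $\xi(1,2),\xi(2,3),\xi(1,3)$). The (simple) system of triangle perspectives $\mathrm{TP}(\xi)$ has the $15$ pairwise distinct points $q^a,q^b,q^c$; $a_i,b_i,c_i$ ($i\in I$); $q^{i,j}=q^{j,i}$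 ($\{i,j\}\in\wp_2(I)$), and the following lines: $L=\{q^a,q^b,q^c\}$; $A_i=\{q^a,b_i,c_i\}$, $B_i=\{q^b,a_i,c_i\}$, $C_i=\{q^c,a_i,b_i\}$ for $i\in I$; $\{q^{i,j},u_i,(\xi(i,j)(u))_j\}$ for distinct $i,j\in I$ and $u\in\mathscr{T}$; and $\{q^{1,2},q^{1,3},q^{2,3}\}$. *)

theory Defs
  imports Main "HOL-Combinatorics.Transposition"
begin

section \<open>Configurations\<close>

text \<open>An incidence structure is a pair of a point set and a set of lines, each line being the
  set of its points.\<close>

type_synonym 'p incidence = "'p set \<times> 'p set set"

abbreviation points :: "'p incidence \<Rightarrow> 'p set" where "points \<equiv> fst"
abbreviation lines :: "'p incidence \<Rightarrow> 'p set set" where "lines \<equiv> snd"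

text \<open>In \<open>configuration v r b k\<close> the parameters come in the order of the
  symbol $(v_r\,b_k)$.\<close>

definition configuration :: "nat \<Rightarrow> nat \<Rightarrow> nat \<Rightarrow> nat \<Rightarrow> 'p incidence \<Rightarrow> bool" where
  "configuration v r b k K \<longleftrightarrow>
     finite (points K) \<and> card (points K) = v \<and>
     (\<forall>l \<in> lines K. l \<subseteq> points K) \<and> card (lines K) = b \<and>
     (\<forall>p \<in> points K. card {l \<in> lines K. p \<in> l} = r) \<and>
     (\<forall>l \<in> lines K. card l = k) \<and>
     (\<forall>p \<in> points K. \<forall>q \<in> points K. p \<noteq> q \<longrightarrow>
        (\<forall>l \<in> lines K. \<forall>m \<in> lines K. p \<in> l \<and> q \<in> l \<and> p \<in> m \<and> q \<in> m \<longrightarrow> l = m))"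

definition isomorphic :: "'p incidence \<Rightarrow> 'q incidence \<Rightarrow> bool" where
  "isomorphic K M \<longleftrightarrow>
     (\<exists>f. bij_betw f (points K) (points M) \<and> (\<lambda>l. f ` l) ` lines K = lines M)"

section \<open>Freely contained complete graphs\<close>

definition pairs :: "'p set \<Rightarrow> 'p set set" where
  "pairs X = {e. e \<subseteq> X \<and> card e = 2}"

definition line_of :: "'p incidence \<Rightarrow> 'p set \<Rightarrow> 'p set" where
  "line_of K e = (THE l. l \<in> lines K \<and> e \<subseteq> l)"

definition freely_contains_complete :: "'p incidence \<Rightarrow> 'p set \<Rightarrow> bool" where
  "freely_contains_complete K X \<longleftrightarrow>
     X \<subseteq> points K \<and>
     (\<forall>e \<in> pairs X. \<exists>!l. l \<in> lines K \<and> e \<subseteq> l) \<and>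
     (\<forall>e \<in> pairs X. \<forall>e' \<in> pairs X.
        line_of K e \<inter> line_of K e' \<noteq> {} \<longrightarrow> (\<exists>p \<in> X. p \<in> e \<and> p \<in> e'))"

definition free_K5s :: "'p incidence \<Rightarrow> 'p set set" where
  "free_K5s K = {X. card X = 5 \<and> freely_contains_complete K X}"

section \<open>Systems of triangle perspectives\<close>

datatype letter = La | Lb | Lc

primrec rho :: "letter \<Rightarrow> letter" where
  "rho La = Lb" | "rho Lb = Lc" | "rho Lc = La"

primrec sigma :: "letter \<Rightarrow> letter \<Rightarrow> letter" where
  "sigma La = transpose Lb Lc"
| "sigma Lb = transpose La Lc"
| "sigma Lc = transpose La Lb"

definition idx :: "nat set" where "idx = {1, 2, 3}"

text \<open>\<open>Apex u\<close> is $q^u$, \<open>Vertex u i\<close> is $u_i$, and \<open>Centre {i, j}\<close> is $q^{i,j} = q^{j,i}$.\<close>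

datatype tp_point = Apex letter | Vertex letter nat | Centre "nat set"

definition perspective_system :: "(nat \<Rightarrow> nat \<Rightarrow> letter \<Rightarrow> letter) \<Rightarrow> bool" where
  "perspective_system \<xi> \<longleftrightarrow>
     (\<forall>i \<in> idx. \<xi> i i = id) \<and>
     (\<forall>i \<in> idx. \<forall>j \<in> idx. bij (\<xi> i j) \<and> \<xi> j i = inv (\<xi> i j))"

definition TP :: "(nat \<Rightarrow> nat \<Rightarrow> letter \<Rightarrow> letter) \<Rightarrow> tp_point incidence" where
  "TP \<xi> =
     (range Apex \<union> {Vertex u i | u i. i \<in> idx} \<union> {Centre {i, j} | i j. i \<in> idx \<and> j \<in> idx \<and> i \<noteq> j},
      {{Apex La, Apex Lb, Apex Lc}} \<union>
      {{Apex La, Vertex Lb i, Vertex Lc i} | i. i \<in> idx} \<union>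
      {{Apex Lb, Vertex La i, Vertex Lc i} | i. i \<in> idx} \<union>
      {{Apex Lc, Vertex La i, Vertex Lb i} | i. i \<in> idx} \<union>
      {{Centre {i, j}, Vertex u i, Vertex (\<xi> i j u) j} | i j u. i \<in> idx \<and> j \<in> idx \<and> i \<noteq> j} \<union>
      {{Centre {1, 2}, Centre {1, 3}, Centre {2, 3}}})"

text \<open>\<open>xi_of (f, g, h)\<close> is the system with $\xi(1,2) = f$, $\xi(2,3) = g$, $\xi(1,3) = h$; note
  the order of the last two. Values outside \<open>idx\<close> are irrelevant for \<open>TP\<close>.\<close>

definition xi_of ::
  "(letter \<Rightarrow> letter) \<times> (letter \<Rightarrow> letter) \<times> (letter \<Rightarrow> letter) \<Rightarrow> nat \<Rightarrow> nat \<Rightarrow> letter \<Rightarrow> letter" where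
  "xi_of t i j = (case t of (f, g, h) \<Rightarrow>
     if (i, j) = (1, 2) then f else if (i, j) = (2, 1) then inv f
     else if (i, j) = (2, 3) then g else if (i, j) = (3, 2) then inv g
     else if (i, j) = (1, 3) then h else if (i, j) = (3, 1) then inv h
     else id)"

lemma perspective_system_xi_of:
  assumes "bij f" "bij g" "bij h"
  shows "perspective_system (xi_of (f, g, h))"
  using assms
  by (auto simp: perspective_system_def xi_of_def idx_def bij_imp_bij_inv inv_inv_eq)

lemma xi_of_unique:
  assumes "perspective_system \<xi>" "i \<in> idx" "j \<in> idx"
  shows "\<xi> i j = xi_of (\<xi> 1 2, \<xi> 2 3, \<xi> 1 3) i j"
proof -
  have "\<xi> 1 1 = id" "\<xi> 2 2 = id" "\<xi> 3 3 = id"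
    "\<xi> 2 1 = inv (\<xi> 1 2)" "\<xi> 3 2 = inv (\<xi> 2 3)" "\<xi> 3 1 = inv (\<xi> 1 3)"
    using assms(1) unfolding perspective_system_def idx_def by blast+
  then show ?thesis
    using assms(2,3) by (auto simp: idx_def xi_of_def)
qed

definition seventeen ::
  "letter \<Rightarrow> letter \<Rightarrow> letter \<Rightarrow>
     ((letter \<Rightarrow> letter) \<times> (letter \<Rightarrow> letter) \<times> (letter \<Rightarrow> letter)) list" where
  "seventeen x y z =
    [(rho, rho, rho), (rho, rho, id), (rho, id, id), (rho, rho, inv rho), (rho, inv rho, id),
     (sigma x, sigma y, sigma z), (sigma x, sigma y, id), (sigma x, rho, id),
     (sigma x, sigma y, rho), (sigma x, sigma y, inv rho),
     (sigma x, sigma x, sigma y), (sigma x, sigma x, rho), (rho, rho, sigma z),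
     (rho, inv rho, sigma z),
     (sigma x, sigma x, sigma x), (id, id, sigma x), (id, id, id)]"

lemma bij_rho: "bij rho"
proof (rule o_bij[of "rho \<circ> rho"])
  show "(rho \<circ> rho) \<circ> rho = id" "rho \<circ> (rho \<circ> rho) = id"
  proof -
    have *: "rho (rho (rho u)) = u" for u by (cases u) auto
    then show "(rho \<circ> rho) \<circ> rho = id" "rho \<circ> (rho \<circ> rho) = id" by (auto simp: fun_eq_iff)
  qed
qed

lemma bij_sigma: "bij (sigma x)"
  by (cases x) auto

lemma perspective_system_seventeen:
  assumes "t \<in> set (seventeen x y z)"
  shows "perspective_system (xi_of t)"
  using assms unfolding seventeen_def
  by (auto intro!: perspective_system_xi_of simp: bij_rho bij_sigma bij_imp_bij_inv)

end

(*
  Two graphs K_5 freely contained in a (15_4 20_3)-configuration meet in exactly one point: every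
  point outside such a graph is the third point of exactly one of its 10 edges, and the 4 lines
  through a vertex are the lines of the 4 edges at it. For three graphs the three intersection
  points are collinear, and the 3 points on none of the graphs form a line whose points are the
  third points of the sides of each of the three remaining triangles; hence the configuration is a
  TP(xi).

  Conjugating by a permutation of the letters and permuting the indices splits the 216 systems into
  18 orbits. Two orbits, those of (id, id, sigma) and (id, sigma, sigma), give isomorphic structures:
  these contain a fourth K_5, and the isomorphism exchanges it with one of the first three. The
  remaining 17 classes are told apart by an integer computed from the triangles of the
  non-collinearity graph.
*)

theory Submission
  imports Defs
begin

section \<open>Configurations and isomorphisms\<close>

text \<open>The structure part rests on two counts. The 10 edges of a free K_5 have distinct third
  points, and 15 - 5 = 10 points lie outside; the 4 edges at a vertex span distinct lines, and a
  vertex has degree 4. By the second count a line meets a free K_5 in no point or in exactly two, so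
  a line through one vertex can always be searched for a second one. Almost every later incidence is
  found in this way.

  The obstacle in telling the classes apart is that a system may contain further graphs K_5. An
  isomorphism then need not respect the chosen three, nor the letters and indices, so inequivalence
  of triples proves nothing about the structures. The separating number therefore refers to
  collinearity alone.

  The letters x, y, z are arbitrary, while rho orients them; their six orders are covered by
  evaluation, one by one.\<close>

lemma finite_lines: "configuration v r b k K \<Longrightarrow> finite (lines K)"
  unfolding configuration_def by (meson PowI finite_Pow_iff finite_subset subsetI)

lemma configuration_line_subset: "configuration v r b k K \<Longrightarrow> \<forall>l \<in> lines K. l \<subseteq> points K"
  unfolding configuration_def by (elim conjE)

lemma configuration_linear:
  assumes "configuration v r b k K" "l \<in> lines K" "m \<in> lines K"
    "p \<in> l" "p \<in> m" "q \<in> l" "q \<in> m" "p \<noteq> q"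
  shows "l = m"
proof -
  have "l \<subseteq> points K" using configuration_line_subset assms by blast
  then show ?thesis using assms unfolding configuration_def by (meson subsetD)
qed

text \<open>Third points are off \<open>X\<close>, so two edge lines can meet only in a common
  vertex or in a common third point. A function \<open>t\<close> for the third points takes the
  place of \<open>line_of\<close>.\<close>

lemma freely_contains_completeI:
  assumes conf: "configuration v r b k K" and X: "X \<subseteq> points K"
    and t: "\<And>p q. p \<in> X \<Longrightarrow> q \<in> X \<Longrightarrow> p \<noteq> q \<Longrightarrow> {p, q, t p q} \<in> lines K \<and> t p q \<notin> X"
    and inj: "\<And>p q p' q'. \<lbrakk>p \<in> X; q \<in> X; p' \<in> X; q' \<in> X; p \<noteq> q; p' \<noteq> q'; t p q = t p' q'\<rbrakk>
      \<Longrightarrow> {p, q} \<inter> {p', q'} \<noteq> {}"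
  shows "freely_contains_complete K X"
proof -
  have uniq: "l = {p, q, t p q}" if "l \<in> lines K" "{p, q} \<subseteq> l" "p \<in> X" "q \<in> X" "p \<noteq> q" for l p q
    using configuration_linear[OF conf that(1), of "{p, q, t p q}" p q] t[OF that(3-5)] that by simp
  have line: "line_of K {p, q} = {p, q, t p q}" if "p \<in> X" "q \<in> X" "p \<noteq> q" for p q
    unfolding line_of_def using t[OF that] uniq that by (intro the_equality) auto
  have pairsE: "\<exists>p q. e = {p, q} \<and> p \<in> X \<and> q \<in> X \<and> p \<noteq> q" if "e \<in> pairs X" for e
    using that unfolding pairs_def by (auto simp: card_2_iff)
  show ?thesis
    unfolding freely_contains_complete_def
  proof (intro conjI ballI impI X)
    fix e assume "e \<in> pairs X"
    then obtain p q where "e = {p, q}" "p \<in> X" "q \<in> X" "p \<noteq> q" using pairsE by blast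
    then show "\<exists>!l. l \<in> lines K \<and> e \<subseteq> l"
      using t[of p q] by (intro ex1I[of _ "{p, q, t p q}"]) (simp_all add: uniq)
  next
    fix e e' assume ee: "e \<in> pairs X" "e' \<in> pairs X" and meet: "line_of K e \<inter> line_of K e' \<noteq> {}"
    obtain p q p' q' where *: "e = {p, q}" "p \<in> X" "q \<in> X" "p \<noteq> q" "e' = {p', q'}" "p' \<in> X" "q' \<in> X"
      "p' \<noteq> q'"
      using pairsE[OF ee(1)] pairsE[OF ee(2)] by blast
    have "{p, q} \<inter> {p', q'} \<noteq> {}" using meet t[of p q] t[of p' q'] inj[of p q p' q'] * line by auto
    then show "\<exists>p \<in> X. p \<in> e \<and> p \<in> e'" using * by blast
  qed
qed

text \<open>Both sides have equally many points and equally many lines, so injectivity forces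
  surjectivity on both; one direction of line preservation is enough.\<close>

lemma isomorphicI:
  assumes K: "configuration v r b k K" and M: "configuration v r b k M"
    and inj: "inj_on f (points K)" and points: "f ` points K \<subseteq> points M"
    and lines: "\<And>l. l \<in> lines K \<Longrightarrow> f ` l \<in> lines M"
  shows "isomorphic K M"
proof -
  have "card (f ` points K) = card (points M)"
    using inj K M by (simp add: card_image configuration_def)
  then have "f ` points K = points M"
    using points M by (simp add: card_subset_eq configuration_def)
  moreover have "inj_on ((`) f) (lines K)"
  proof (rule inj_on_subset)
    show "inj_on ((`) f) (Pow (points K))" using inj by (rule inj_on_image_Pow)
    show "lines K \<subseteq> Pow (points K)" using K by (auto simp: configuration_def)
  qed
  then have "card ((`) f ` lines K) = card (lines M)"
    using K M by (simp add: card_image configuration_def)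
  then have "(`) f ` lines K = lines M"
    using lines finite_lines[OF M] by (intro card_subset_eq) auto
  ultimately show ?thesis
    unfolding isomorphic_def bij_betw_def using inj by blast
qed

text \<open>The lines have to lie in the point set because \<open>inv_into (points K) f\<close>
  undoes \<open>f\<close> only there.\<close>

lemma isomorphic_sym:
  assumes "isomorphic K M" and K: "\<forall>l \<in> lines K. l \<subseteq> points K"
  shows "isomorphic M K"
proof -
  obtain f where f: "bij_betw f (points K) (points M)" "(\<lambda>l. f ` l) ` lines K = lines M"
    using assms(1) unfolding isomorphic_def by blast
  have "inv_into (points K) f ` f ` l = l" if "l \<in> lines K" for l
    using that K f(1) by (intro inv_into_image_cancel) (auto simp: bij_betw_def)
  then have "(\<lambda>l. inv_into (points K) f ` l) ` lines M = lines K"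
    unfolding f(2)[symmetric] image_image by simp
  then show ?thesis
    unfolding isomorphic_def using bij_betw_inv_into[OF f(1)] by blast
qed

lemma isomorphic_trans:
  assumes "isomorphic K M" "isomorphic M N"
  shows "isomorphic K N"
proof -
  obtain f g where f: "bij_betw f (points K) (points M)" "(\<lambda>l. f ` l) ` lines K = lines M"
    and g: "bij_betw g (points M) (points N)" "(\<lambda>l. g ` l) ` lines M = lines N"
    using assms unfolding isomorphic_def by (elim exE conjE)
  have "(\<lambda>l. (g \<circ> f) ` l) ` lines K = lines N"
    unfolding g(2)[symmetric] f(2)[symmetric] by (simp add: image_image image_comp)
  then show ?thesis
    unfolding isomorphic_def using bij_betw_trans[OF f(1) g(1)] by (intro exI conjI)
qed

section \<open>Systems of triangle perspectives\<close>

lemma UNIV_letter: "UNIV = {La, Lb, Lc}"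
  using letter.exhaust by blast

lemma ex_letter: "(\<exists>u. P u) \<longleftrightarrow> P La \<or> P Lb \<or> P Lc"
  by (metis letter.exhaust)

lemma all_letter: "(\<forall>u. P u) \<longleftrightarrow> P La \<and> P Lb \<and> P Lc"
  by (metis letter.exhaust)

lemma Compl_letter: "- {La} = {Lb, Lc}" "- {Lb} = {La, Lc}" "- {Lc} = {La, Lb}"
  using letter.exhaust by auto

lemma card_Compl_letter: "card (- {u :: letter}) = 2"
  by (cases u) (auto simp: Compl_letter)

text \<open>The value on equal letters is junk.\<close>

fun third_letter :: "letter \<Rightarrow> letter \<Rightarrow> letter" where
  "third_letter La Lb = Lc"
| "third_letter Lb La = Lc"
| "third_letter La Lc = Lb"
| "third_letter Lc La = Lb"
| "third_letter _ _ = La"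

text \<open>The side of triangle i opposite to u_i, extended by q^u: the lines A_i, B_i, C_i as one
  family.\<close>

definition side :: "letter \<Rightarrow> nat \<Rightarrow> tp_point set" where
  "side u i = insert (Apex u) ((\<lambda>v. Vertex v i) ` (- {u}))"

definition ray :: "(nat \<Rightarrow> nat \<Rightarrow> letter \<Rightarrow> letter) \<Rightarrow> nat \<Rightarrow> nat \<Rightarrow> letter \<Rightarrow> tp_point set" where
  "ray \<xi> i j u = {Centre {i, j}, Vertex u i, Vertex (\<xi> i j u) j}"

definition axis :: "tp_point set" where
  "axis = {Centre {1, 2}, Centre {1, 3}, Centre {2, 3}}"

lemma lines_TP:
  "lines (TP \<xi>) = {range Apex, axis} \<union> {side u i | u i. i \<in> idx} \<union>
     {ray \<xi> i j u | i j u. i \<in> idx \<and> j \<in> idx \<and> i \<noteq> j}"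
proof -
  have "range Apex = {Apex La, Apex Lb, Apex Lc}" by (auto simp: UNIV_letter)
  moreover have "{side u i | u i. i \<in> idx} = {side La i | i. i \<in> idx} \<union> {side Lb i | i. i \<in> idx} \<union>
    {side Lc i | i. i \<in> idx}"
    by (auto simp: ex_letter)
  moreover have "side La i = {Apex La, Vertex Lb i, Vertex Lc i}"
    "side Lb i = {Apex Lb, Vertex La i, Vertex Lc i}"
     "side Lc i = {Apex Lc, Vertex La i, Vertex Lb i}" for i
    by (simp_all add: side_def Compl_letter)
  ultimately show ?thesis
    unfolding TP_def ray_def axis_def snd_conv by (simp only: Un_ac insert_is_Un[of "range Apex" "{_}"])
      (simp only: Un_ac  Un_insert_left Un_insert_right insert_commute Un_empty_left Un_empty_right )
qed

lemma points_TP: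
  "points (TP \<xi>) = range Apex \<union> {Vertex u i | u i. i \<in> idx} \<union>
     {Centre {i, j} | i j. i \<in> idx \<and> j \<in> idx \<and> i \<noteq> j}"
  by (simp add: TP_def)

lemma Centre_idx:
  "{Centre {i, j} | i j. i \<in> idx \<and> j \<in> idx \<and> i \<noteq> j} = axis"
proof
  show "{Centre {i, j} | i j. i \<in> idx \<and> j \<in> idx \<and> i \<noteq> j} \<subseteq> axis" by (auto simp: idx_def axis_def)
  have "Centre {a, b} \<in> {Centre {i, j} | i j. i \<in> idx \<and> j \<in> idx \<and> i \<noteq> j}"
    if "a \<in> idx" "b \<in> idx" "a \<noteq> b" for a b
    using that by blast
  from this[of 1 2] this[of 2 3] this[of 1 3]
  show "axis \<subseteq> {Centre {i, j} | i j. i \<in> idx \<and> j \<in> idx \<and> i \<noteq> j}" by (simp add: idx_def axis_def)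
qed

definition point_list :: "tp_point list" where
  "point_list = map Apex [La, Lb, Lc] @ [Vertex u i. i \<leftarrow> [1, 2, 3], u \<leftarrow> [La, Lb, Lc]] @
     [Centre {1, 2}, Centre {1, 3}, Centre {2, 3}]"

lemma points_TP_list: "points (TP \<xi>) = set point_list"
  unfolding points_TP Centre_idx by (auto simp: point_list_def idx_def UNIV_letter ex_letter axis_def)

lemma distinct_point_list: "distinct point_list"
  by (simp add: point_list_def doubleton_eq_iff)

text \<open>Computes the third point from two collinear points, so that a line is determined by any two
  of its points; the values on other pairs are junk.\<close>

fun third_point :: "(nat \<Rightarrow> nat \<Rightarrow> letter \<Rightarrow> letter) \<Rightarrow> tp_point \<Rightarrow> tp_point \<Rightarrow> tp_point" where
  "third_point \<xi> (Apex u) (Apex v) = Apex (third_letter u v)"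
| "third_point \<xi> (Apex u) (Vertex v i) = Vertex (third_letter u v) i"
| "third_point \<xi> (Vertex v i) (Apex u) = Vertex (third_letter u v) i"
| "third_point \<xi> (Vertex u i) (Vertex v j) =
     (if i = j then Apex (third_letter u v) else Centre {i, j})"
| "third_point \<xi> (Vertex u i) (Centre e) = (let j = the_elem (e - {i}) in Vertex (\<xi> i j u) j)"
| "third_point \<xi> (Centre e) (Vertex u i) = (let j = the_elem (e - {i}) in Vertex (\<xi> i j u) j)"
| "third_point \<xi> (Centre e) (Centre e') = Centre ((e - e') \<union> (e' - e))"
| "third_point \<xi> p q = p"

lemma perspective_inverse:
  assumes "perspective_system \<xi>" "i \<in> idx" "j \<in> idx"
  shows "\<xi> j i (\<xi> i j u) = u"
  using assms unfolding perspective_system_def by (metis bij_is_inj inv_f_f)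

lemma line_eq_third_point:
  assumes \<xi>: "perspective_system \<xi>" and l: "l \<in> lines (TP \<xi>)" and pq: "p \<in> l" "q \<in> l" "p \<noteq> q"
  shows "l = {p, q, third_point \<xi> p q}"
proof -
  \<comment> \<open>The six equations cover all ordered pairs of points of a line, so one listing of
    each line suffices.\<close>
  have *: ?thesis if "l = {x, y, z}" "third_point \<xi> x y = z" "third_point \<xi> y x = z"
    "third_point \<xi> x z = y" "third_point \<xi> z x = y" "third_point \<xi> y z = x" "third_point \<xi> z y = x"
      for x y z
    using that pq by auto
  consider "l = range Apex" | "l = axis" | u i where "i \<in> idx" "l = side u i"
    | i j u where "i \<in> idx" "j \<in> idx" "i \<noteq> j" "l = ray \<xi> i j u"
    using l unfolding lines_TP by blast
  then show ?thesis
  proof cases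
    case 1
    show ?thesis by (rule *[of "Apex La" "Apex Lb" "Apex Lc"]) (auto simp: 1 UNIV_letter)
  next
    case 2
    show ?thesis
      by (rule *[of "Centre {1,2}" "Centre {1,3}" "Centre {2,3}"]) (auto simp: 2 axis_def)
  next
    case 3
    \<comment> \<open>The witnesses are the two letters other than \<open>u\<close>, in alphabetical
      order.\<close>
    then show ?thesis
      by (cases u) (rule *[of "Apex u" "Vertex (if u = La then Lb else La) i"
        "Vertex (if u = Lc then Lb else Lc) i"]; simp add: side_def Compl_letter)+
  next
    case 4
    have "{i, j} - {i} = {j}" "{i, j} - {j} = {i}" using 4 by auto
    with 4 show ?thesis
      by (intro *[of "Centre {i, j}" "Vertex u i" "Vertex (\<xi> i j u) j"])
        (auto simp: ray_def perspective_inverse[OF \<xi>] insert_commute)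
  qed
qed

text \<open>A perspective line can be read from either of its two triangles, so each unordered pair
  of indices has to be treated only once.\<close>

lemma ray_commute:
  assumes "perspective_system \<xi>" "i \<in> idx" "j \<in> idx"
  shows "ray \<xi> j i (\<xi> i j u) = ray \<xi> i j u"
  unfolding ray_def by (simp add: perspective_inverse[OF assms] insert_commute)

lemma third_letter_neq [simp]: "u \<noteq> v \<Longrightarrow> third_letter u v \<noteq> u" "u \<noteq> v \<Longrightarrow> third_letter u v \<noteq> v"
  by (cases u; cases v; simp)+

lemma bij_perspective: "perspective_system \<xi> \<Longrightarrow> i \<in> idx \<Longrightarrow> j \<in> idx \<Longrightarrow> bij (\<xi> i j)"
  unfolding perspective_system_def by blast

lemma mem_side [simp]: "Apex v \<in> side u i \<longleftrightarrow> v = u" "Vertex v j \<in> side u i \<longleftrightarrow> i = j \<and> v \<noteq> u"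
  "Centre e \<notin> side u i"
  by (auto simp: side_def)

lemma side_inject [simp]: "side u i = side v j \<longleftrightarrow> u = v \<and> i = j"
proof
  assume *: "side u i = side v j"
  have "u = v" using * mem_side(1) by blast
  moreover obtain w where "w \<noteq> u" using third_letter_neq by (metis letter.distinct(1))
  ultimately show "u = v \<and> i = j" using * mem_side(2) by blast
qed simp

lemma mem_ray: "Apex v \<notin> ray \<xi> i j u"
  "Vertex v k \<in> ray \<xi> i j u \<longleftrightarrow> (v = u \<and> k = i \<or> v = \<xi> i j u \<and> k = j)"
  "Centre e \<in> ray \<xi> i j u \<longleftrightarrow> e = {i, j}"
  by (auto simp: ray_def)

lemma mem_axis: "Apex v \<notin> axis" "Vertex v k \<notin> axis"
  "i \<in> idx \<Longrightarrow> j \<in> idx \<Longrightarrow> i \<noteq> j \<Longrightarrow> Centre {i, j} \<in> axis"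
  by (auto simp: axis_def idx_def insert_commute)

section \<open>Point degrees and the configuration axioms for TP(xi)\<close>

lemma degree_Apex:
  "card {l \<in> lines (TP \<xi>). Apex u \<in> l} = 4"
proof -
  have "{l \<in> lines (TP \<xi>). Apex u \<in> l} = insert (range Apex) (side u ` idx)"
    unfolding lines_TP by (auto simp: mem_ray mem_axis)
  moreover have "range Apex \<notin> side u ` idx"
  proof
    assume "range Apex \<in> side u ` idx"
    then obtain i where "range Apex = side u i" by blast
    then have "Apex v \<in> side u i" for v by blast
    then show False by (metis mem_side(1) letter.distinct(1))
  qed
  moreover have "card (side u ` idx) = 3" by (subst card_image) (auto simp: inj_on_def idx_def)
  ultimately show ?thesis by (simp add: idx_def)
qed

text \<open>Two sides of triangle i pass through u_i, and one perspective line towards each of the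
  other two triangles.\<close>

lemma degree_Vertex:
  assumes \<xi>: "perspective_system \<xi>" and i: "i \<in> idx"
  shows "card {l \<in> lines (TP \<xi>). Vertex u i \<in> l} = 4"
proof -
  have "{l \<in> lines (TP \<xi>). Vertex u i \<in> l} = (\<lambda>v. side v i) ` (- {u}) \<union> (\<lambda>j. ray \<xi> i j u) ` (idx -
    {i})" (is "?L = ?R")
  proof
    have "ray \<xi> j i v \<in> (\<lambda>k. ray \<xi> i k (\<xi> j i v)) ` (idx - {i})"
      if "j \<in> idx" "j \<noteq> i" for j v
      using ray_commute[OF \<xi> that(1) i] that by blast
    then show "?L \<subseteq> ?R"
      unfolding lines_TP by (auto simp: mem_ray mem_axis)
    show "?R \<subseteq> ?L" using i
      unfolding lines_TP by (auto simp: mem_ray mem_axis)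
  qed
  moreover have "card ((\<lambda>v. side v i) ` (- {u})) = 2"
    by (subst card_image) (auto simp: inj_on_def card_Compl_letter)
  moreover have "card ((\<lambda>j. ray \<xi> i j u) ` (idx - {i})) = 2"
  proof (subst card_image)
    show "inj_on (\<lambda>j. ray \<xi> i j u) (idx - {i})"
    proof (rule inj_onI)
      fix j k assume "j \<in> idx - {i}" "k \<in> idx - {i}" "ray \<xi> i j u = ray \<xi> i k u"
      then show "j = k" using mem_ray(3)[of "{i, j}" \<xi> i] by (auto simp: doubleton_eq_iff)
    qed
    show "card (idx - {i}) = 2" using i by (auto simp: idx_def)
  qed
  moreover have "(\<lambda>v. side v i) ` (- {u}) \<inter> (\<lambda>j. ray \<xi> i j u) ` (idx - {i}) = {}"
    using mem_ray(1) mem_side(1) by blast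
  moreover have "finite idx" by (simp add: idx_def)
  ultimately show ?thesis by (simp add: card_Un_disjoint finite_subset[OF subset_UNIV] UNIV_letter)
qed

lemma degree_Centre:
  assumes \<xi>: "perspective_system \<xi>" and ij: "i \<in> idx" "j \<in> idx" "i \<noteq> j"
  shows "card {l \<in> lines (TP \<xi>). Centre {i, j} \<in> l} = 4"
proof -
  have "{l \<in> lines (TP \<xi>). Centre {i, j} \<in> l} = insert axis (ray \<xi> i j ` UNIV)" (is "?L = ?R")
  proof
    have "ray \<xi> j i u \<in> ray \<xi> i j ` UNIV" for u
      using ray_commute[OF \<xi> ij(2,1)] by (metis rangeI)
    then show "?L \<subseteq> ?R"
      unfolding lines_TP by (auto simp: mem_ray mem_axis doubleton_eq_iff)
    show "?R \<subseteq> ?L" using ij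
      unfolding lines_TP by (auto simp: mem_ray mem_axis)
  qed
  moreover have "card (range (ray \<xi> i j)) = 3"
  proof (subst card_image)
    show "inj (ray \<xi> i j)"
    proof (rule injI)
      fix u v assume "ray \<xi> i j u = ray \<xi> i j v"
      then show "u = v" using mem_ray(2)[of u i \<xi> i j] ij by auto
    qed
  qed (simp add: UNIV_letter)
  moreover have "axis \<notin> range (ray \<xi> i j)" using mem_ray(2) mem_axis(2) by blast
  ultimately show ?thesis by (simp add: finite_subset[OF subset_UNIV] UNIV_letter)
qed

theorem configuration_TP:
  assumes \<xi>: "perspective_system \<xi>"
  shows "configuration 15 4 20 3 (TP \<xi>)"
proof -
  let ?P = "points (TP \<xi>)" and ?L = "lines (TP \<xi>)"
  have finP: "finite ?P" and cardP: "card ?P = 15"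
    using distinct_card[OF distinct_point_list] unfolding points_TP_list
      by (simp_all add: point_list_def)
  have sub: "l \<subseteq> ?P" if "l \<in> ?L" for l
    using that unfolding points_TP Centre_idx lines_TP by (auto simp: side_def ray_def mem_axis)
  have finL: "finite ?L" using finP sub by (meson PowI finite_Pow_iff finite_subset subsetI)
  have deg: "card {l \<in> ?L. p \<in> l} = 4" if "p \<in> ?P" for p
    using that unfolding points_TP
    by (auto simp: degree_Apex degree_Vertex[OF \<xi>] degree_Centre[OF \<xi>])
  have card_line: "card l = 3" if "l \<in> ?L" for l
  proof -
    have "card (side u i) = 3" for u i
      by (cases u) (auto simp: side_def Compl_letter)
    moreover have "card axis = 3" by (simp add: axis_def doubleton_eq_iff)
    moreover have "card (range Apex) = 3" by (subst card_image) (auto simp: UNIV_letter inj_on_def)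
    ultimately show ?thesis using that unfolding lines_TP by (auto simp: ray_def)
  qed
  \<comment> \<open>Counting flags, 3 b = 4 * 15, yields the 20 lines without deciding which of the
    descriptions in \<open>lines_TP\<close> coincide.\<close>
  have "3 * card ?L = (\<Sum>l \<in> ?L. card {p \<in> ?P. p \<in> l})"
  proof -
    have "{p \<in> ?P. p \<in> l} = l" if "l \<in> ?L" for l using sub[OF that] by blast
    then show ?thesis using card_line by simp
  qed
  also have "\<dots> = 4 * card ?P"
    using deg finP finL by (intro sum_multicount) auto
  finally have "card ?L = 20" using cardP by simp
  moreover have "l = m" if "l \<in> ?L" "m \<in> ?L" "p \<in> l" "q \<in> l" "p \<in> m" "q \<in> m" "p \<noteq> q" for l m p q
    using line_eq_third_point[OF \<xi>, of l p q] line_eq_third_point[OF \<xi>, of m p q] that by simp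
  ultimately show ?thesis
    unfolding configuration_def using finP cardP sub deg card_line by (intro conjI ballI impI; (elim
      conjE)?) simp_all
qed

section \<open>The three complete graphs inside TP(xi)\<close>

definition free_vertices :: "nat \<Rightarrow> tp_point set" where
  "free_vertices i = range (\<lambda>u. Vertex u i) \<union> {Centre {i, j} | j. j \<in> idx \<and> j \<noteq> i}"

lemma third_letter_side: "u \<noteq> v \<Longrightarrow> side (third_letter u v) i = {Vertex u i, Vertex v i, Apex
  (third_letter u v)}"
  by (cases u; cases v) (auto simp: side_def Compl_letter)

lemma third_letter_eq_iff: "u \<noteq> v \<Longrightarrow> u' \<noteq> v' \<Longrightarrow> third_letter u v = third_letter u' v' \<Longrightarrow>
  {u,v} \<inter> {u',v'} \<noteq> {}"
  by (cases u; cases v; cases u'; cases v'; simp)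

lemma freely_contains_free_vertices:
  assumes \<xi>: "perspective_system \<xi>" and i: "i \<in> idx"
  shows "freely_contains_complete (TP \<xi>) (free_vertices i)"
proof (rule freely_contains_completeI[OF configuration_TP[OF \<xi>], where t = "third_point \<xi>"])
  show "free_vertices i \<subseteq> points (TP \<xi>)" using i by (auto simp: free_vertices_def points_TP)
  have diff: "{i, j} - {i} = {j}" if "j \<noteq> i" for j using that by auto
  have ray: "{Vertex u i, Centre {i, j}, Vertex (\<xi> i j u) j} \<in> lines (TP \<xi>)"
     "{Centre {i, j}, Vertex u i, Vertex (\<xi> i j u) j} \<in> lines (TP \<xi>)"  if "j \<in> idx" "j \<noteq> i" for j u
  proof -
    have "ray \<xi> i j u \<in> lines (TP \<xi>)" using that i unfolding lines_TP by blast
    then show "{Vertex u i, Centre {i, j}, Vertex (\<xi> i j u) j} \<in> lines (TP \<xi>)"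
     "{Centre {i, j}, Vertex u i, Vertex (\<xi> i j u) j} \<in> lines (TP \<xi>)"
      by (simp_all add: ray_def insert_commute)
  qed
  have side: "{Vertex u i, Vertex v i, Apex (third_letter u v)} \<in> lines (TP \<xi>)" if "u \<noteq> v" for u v
    using third_letter_side[OF that] i unfolding lines_TP by blast
  have axis: "{Centre {i, j}, Centre {i, k}, Centre ({i, j} - {i, k} \<union> ({i, k} - {i, j}))} \<in> lines
    (TP \<xi>)" if "j \<in> idx" "k \<in> idx" "j \<noteq> i" "k \<noteq> i" "j \<noteq> k" for j k
  proof -
    have e: "{i, j} - {i, k} \<union> ({i, k} - {i, j}) = {j, k}" using that by auto
    have "{Centre {i, j}, Centre {i, k}, Centre {j, k}} = axis"
      using that i unfolding idx_def axis_def by (auto simp: insert_commute)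
    then show "{Centre {i, j}, Centre {i, k}, Centre ({i, j} - {i, k} \<union> ({i, k} - {i, j}))} \<in> lines
      (TP \<xi>)"
       unfolding e lines_TP by blast
  qed
  have ne: "{j, k} \<noteq> {i, m}" if "j \<noteq> i" "k \<noteq> i" for j k m
    using that by auto
  fix p q assume pq: "p \<in> free_vertices i" "q \<in> free_vertices i" "p \<noteq> q"
  show "{p, q, third_point \<xi> p q} \<in> lines (TP \<xi>) \<and> third_point \<xi> p q \<notin> free_vertices i"
    using pq axis(1) unfolding free_vertices_def
    by (auto simp: diff ray ne) (use side in blast)+
  fix p' q' assume pq': "p' \<in> free_vertices i" "q' \<in> free_vertices i" "p' \<noteq> q'"
    and eq: "third_point \<xi> p q = third_point \<xi> p' q'"
  \<comment> \<open>The kind of the third point reveals the kind of the edge: an apex for two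
    vertices of the triangle, a vertex for a vertex and a centre, a centre for two centres. Equal
    third points thus come from edges of equal kind.\<close>
  have kind: "(\<exists>u v. u \<noteq> v \<and> {p, q} = {Vertex u i, Vertex v i} \<and> third_point \<xi> p q =
    Apex (third_letter u v)) \<or>
      (\<exists>u j. j \<in> idx \<and> j \<noteq> i \<and> {p, q} = {Vertex u i, Centre {i, j}} \<and> third_point \<xi> p q = Vertex (\<xi>
        i j u) j) \<or>
      (\<exists>j k e. {j, k} \<subseteq> idx - {i} \<and> j \<noteq> k \<and> {p, q} = {Centre {i, j}, Centre {i, k}} \<and> third_point \<xi>
        p q = Centre e)"
    if fv: "p \<in> free_vertices i" "q \<in> free_vertices i" "p \<noteq> q" for p q
  proof (cases p)
    case Apex
    with fv show ?thesis by (auto simp: free_vertices_def)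
  next
    case (Vertex u)
    with fv show ?thesis by (cases q) (auto simp: free_vertices_def diff)
  next
    case (Centre e)
    then obtain j where j: "e = {i, j}" "j \<in> idx" "j \<noteq> i" using fv(1) by (auto simp: free_vertices_def)
    show ?thesis
    proof (cases q)
      case Apex
      with fv show ?thesis by (auto simp: free_vertices_def)
    next
      case q: (Vertex u)
      then have "q = Vertex u i" using fv(2) by (auto simp: free_vertices_def)
      then have "{p, q} = {Vertex u i, Centre {i, j}}" "third_point \<xi> p q = Vertex (\<xi> i j u) j"
        using Centre j by (auto simp: diff)
      with j have "\<exists>u j. j \<in> idx \<and> j \<noteq> i \<and> {p, q} = {Vertex u i, Centre {i, j}} \<and>
        third_point \<xi> p q = Vertex (\<xi> i j u) j"
        by (intro exI conjI)
      then show ?thesis by (intro disjI2 disjI1)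
    next
      case q: (Centre e')
      then obtain k where "e' = {i, k}" "k \<in> idx" "k \<noteq> i" using fv(2) by (auto simp: free_vertices_def)
      have "{j, k} \<subseteq> idx - {i}" "j \<noteq> k"  "{p, q} = {Centre {i, j}, Centre {i, k}}"
        "third_point \<xi> p q = Centre ((e - e') \<union> (e' - e))"
        using \<open>e' = {i, k}\<close> \<open>k \<in> idx\<close> \<open>k \<noteq> i\<close> q Centre j fv(3) by auto
      then have "\<exists>j k f. {j, k} \<subseteq> idx - {i} \<and> j \<noteq> k \<and> {p, q} = {Centre {i, j}, Centre {i, k}} \<and>
        third_point \<xi> p q = Centre f"
        by (intro exI conjI)
      then show ?thesis by (intro disjI2)
    qed
  qed
  \<comment> \<open>Only two indices differ from \<open>i\<close>, so two edges between centres
    always share a centre.\<close>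
  have two: "j' \<in> {j, k}" if "{j, k} \<subseteq> idx - {i}" "j \<noteq> k" "{j', k'} \<subseteq> idx - {i}" for j k j' k'
    using that i by (auto simp: idx_def)
  show "{p, q} \<inter> {p', q'} \<noteq> {}"
    using kind[OF pq]
  proof (elim disjE exE conjE)
    fix u v assume uv: "u \<noteq> v" and e: "{p, q} = {Vertex u i, Vertex v i}"
      and t: "third_point \<xi> p q = Apex (third_letter u v)"
    have "\<exists>u' v'. u' \<noteq> v' \<and> {p', q'} = {Vertex u' i, Vertex v' i} \<and> third_letter u v =
      third_letter u' v'"
      using kind[OF pq'] by (simp add: eq[symmetric] t)
    then obtain u' v' where *: "u' \<noteq> v'" "{p', q'} = {Vertex u' i, Vertex v' i}"
      "third_letter u v = third_letter u' v'"
      by blast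
    have "{u, v} \<inter> {u', v'} \<noteq> {}" by (rule third_letter_eq_iff[OF uv *(1,3)])
    then have "(\<lambda>w. Vertex w i) ` ({u, v} \<inter> {u', v'}) \<noteq> {}" by simp
    moreover have "(\<lambda>w. Vertex w i) ` ({u, v} \<inter> {u', v'}) \<subseteq> {p, q} \<inter> {p', q'}"
      unfolding e *(2) by auto
    ultimately show ?thesis by blast
  next
    fix u j assume "j \<in> idx" and e: "{p, q} = {Vertex u i, Centre {i, j}}"
      and t: "third_point \<xi> p q = Vertex (\<xi> i j u) j"
    have "\<exists>u'. {p', q'} = {Vertex u' i, Centre {i, j}}"
      using kind[OF pq'] by (simp add: eq[symmetric] t) blast
    then obtain u' where *: "{p', q'} = {Vertex u' i, Centre {i, j}}"
      by blast
    then show ?thesis unfolding e * by simp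
  next
    fix j k f assume jk: "{j, k} \<subseteq> idx - {i}" "j \<noteq> k"
      and e: "{p, q} = {Centre {i, j}, Centre {i, k}}" and t: "third_point \<xi> p q = Centre f"
    have "\<exists>j' k'. {j', k'} \<subseteq> idx - {i} \<and> j' \<noteq> k' \<and> {p', q'} = {Centre {i, j'}, Centre {i, k'}}"
      using kind[OF pq'] by (simp add: eq[symmetric] t)
    then obtain j' k' where *: "{j', k'} \<subseteq> idx - {i}" "{p', q'} = {Centre {i, j'}, Centre {i, k'}}"
      by blast
    show ?thesis using two[OF jk *(1)] unfolding e * by (elim insertE emptyE) simp_all
  qed
qed

lemma card_free_vertices:
  assumes i: "i \<in> idx"
  shows "card (free_vertices i) = 5"
proof -
  have "free_vertices i = range (\<lambda>u. Vertex u i) \<union> (\<lambda>j. Centre {i, j}) ` (idx - {i})"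
    by (auto simp: free_vertices_def)
  moreover have "card (range (\<lambda>u. Vertex u i)) = 3" by (subst card_image) (auto simp: inj_on_def
    UNIV_letter)
  moreover have "card ((\<lambda>j. Centre {i, j}) ` (idx - {i})) = 2"
  proof (subst card_image)
    show "inj_on (\<lambda>j. Centre {i, j}) (idx - {i})" by (rule inj_onI) (auto simp: doubleton_eq_iff)
    show "card (idx - {i}) = 2" using i by (auto simp: idx_def)
  qed
  moreover have "range (\<lambda>u. Vertex u i) \<inter> (\<lambda>j. Centre {i, j}) ` (idx - {i}) = {}" by blast
  moreover have "finite (range (\<lambda>u. Vertex u i))" "finite (idx - {i})"
    by (simp_all add: UNIV_letter idx_def)
  ultimately show ?thesis by (simp add: card_Un_disjoint)
qed

lemma card_free_K5s_TP:
  assumes \<xi>: "perspective_system \<xi>"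
  shows "card (free_K5s (TP \<xi>)) \<ge> 3"
proof -
  have "free_vertices ` idx \<subseteq> free_K5s (TP \<xi>)"
    using freely_contains_free_vertices[OF \<xi>] card_free_vertices by (auto simp: free_K5s_def)
  moreover have "finite (free_K5s (TP \<xi>))"
  proof (rule finite_subset)
    show "free_K5s (TP \<xi>) \<subseteq> Pow (points (TP \<xi>))"
      by (simp add: free_K5s_def freely_contains_complete_def Collect_mono_iff Pow_def)
  qed (simp add: points_TP_list)
  moreover have "card (free_vertices ` idx) = 3"
  proof (subst card_image)
    have "Vertex La i \<in> free_vertices j \<longleftrightarrow> i = j" for i j by (auto simp: free_vertices_def)
    then show "inj_on free_vertices idx" by (metis inj_onI)
  qed (simp add: idx_def)
  ultimately show ?thesis by (metis card_mono)
qed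

section \<open>Graphs \<open>K\<^sub>5\<close> in a binomial partial Steiner triple system\<close>

locale partial_steiner =
  fixes K :: "'p incidence"
  assumes conf: "configuration 15 4 20 3 K"
begin

lemma line_subset: "l \<in> lines K \<Longrightarrow> l \<subseteq> points K"
  using configuration_line_subset[OF conf] by blast

lemma lines_eqI:
  assumes "l \<in> lines K" "m \<in> lines K" "p \<in> l" "p \<in> m" "q \<in> l" "q \<in> m" "p \<noteq> q"
  shows "l = m"
  using configuration_linear[OF conf] assms by blast

lemma line_third:
  assumes "l \<in> lines K" "p \<in> l" "q \<in> l" "p \<noteq> q"
  obtains r where "l = {p, q, r}" "r \<noteq> p" "r \<noteq> q"
proof -
  have "card (l - {p, q}) = 1"
    using conf assms by (simp add: configuration_def card_Diff_subset)
  then obtain r where "l - {p, q} = {r}" by (auto simp: card_1_singleton_iff)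
  then show thesis using that assms by blast
qed

lemma free_edge:
  assumes "X \<in> free_K5s K" "p \<in> X" "q \<in> X" "p \<noteq> q"
  shows "\<exists>!l. l \<in> lines K \<and> {p, q} \<subseteq> l"
proof -
  have "\<forall>e \<in> pairs X. \<exists>!l. l \<in> lines K \<and> e \<subseteq> l"
    using assms(1) unfolding free_K5s_def freely_contains_complete_def mem_Collect_eq by (elim conjE)
  moreover have "{p, q} \<in> pairs X" using assms by (simp add: pairs_def)
  ultimately show ?thesis by (rule bspec)
qed

lemma line_of_eq:
  assumes X: "X \<in> free_K5s K" and l: "l \<in> lines K" "{p, q} \<subseteq> l" and pq: "p \<in> X" "q \<in> X" "p \<noteq> q"
  shows "line_of K {p, q} = l"
  unfolding line_of_def using free_edge[OF X pq] l by (intro the1_equality) simp_all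

lemma free_common_vertex:
  assumes X: "X \<in> free_K5s K" and l: "l \<in> lines K" "{p, q} \<subseteq> l" "p \<in> X" "q \<in> X" "p \<noteq> q"
    and m: "m \<in> lines K" "{p', q'} \<subseteq> m" "p' \<in> X" "q' \<in> X" "p' \<noteq> q'"
    and "r \<in> l" "r \<in> m"
  shows "{p, q} \<inter> {p', q'} \<noteq> {}"
proof -
  have pairs: "{p, q} \<in> pairs X" "{p', q'} \<in> pairs X" using l m by (simp_all add: pairs_def)
  have meet: "line_of K {p, q} \<inter> line_of K {p', q'} \<noteq> {}"
    using line_of_eq[OF X l] line_of_eq[OF X m] assms(12,13) by blast
  have "\<forall>e \<in> pairs X. \<forall>e' \<in> pairs X.
      line_of K e \<inter> line_of K e' \<noteq> {} \<longrightarrow> (\<exists>p \<in> X. p \<in> e \<and> p \<in> e')"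
    using X unfolding free_K5s_def freely_contains_complete_def mem_Collect_eq by (elim conjE)
  from this[rule_format, OF pairs meet] show ?thesis by blast
qed

lemma free_K5_subset: "X \<in> free_K5s K \<Longrightarrow> X \<subseteq> points K"
  and free_K5_card: "X \<in> free_K5s K \<Longrightarrow> card X = 5"
  by (simp_all add: free_K5s_def freely_contains_complete_def)

lemma free_K5_finite: "X \<in> free_K5s K \<Longrightarrow> finite X"
  using free_K5_card card.infinite by fastforce

lemma free_line:
  assumes X: "X \<in> free_K5s K" and pq: "p \<in> X" "q \<in> X" "p \<noteq> q"
  obtains l where "l \<in> lines K" "{p, q} \<subseteq> l"
  using free_edge[OF X pq] that by (elim ex1E conjE)

text \<open>If the third point \<open>r\<close> were in \<open>X\<close>, a vertex \<open>s\<close>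
  off the line would give an edge {r, s} whose line meets that of {p, q} in \<open>r\<close>,
  although the two edges are disjoint.\<close>

lemma free_third:
  assumes X: "X \<in> free_K5s K" and pq: "p \<in> X" "q \<in> X" "p \<noteq> q"
  obtains r where "{p, q, r} \<in> lines K" "r \<notin> X"
proof -
  obtain l where l: "l \<in> lines K" "{p, q} \<subseteq> l" using free_line[OF assms] .
  then obtain r where r: "l = {p, q, r}" "r \<noteq> p" "r \<noteq> q" using line_third pq by (metis insert_subset)
  have "r \<notin> X"
  proof
    assume "r \<in> X"
    have "card {p, q, r} \<le> 3" by (simp add: card_insert_if)
    then have "\<not> X \<subseteq> {p, q, r}" using free_K5_card[OF X] card_mono[of "{p, q, r}" X] by auto
    then obtain s where s: "s \<in> X" "s \<notin> {p, q, r}" by blast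
    obtain m where m: "m \<in> lines K" "{r, s} \<subseteq> m" using free_line[OF X \<open>r \<in> X\<close> s(1)] s by blast
    have "{p, q} \<inter> {r, s} \<noteq> {}"
      by (rule free_common_vertex[OF X l pq m \<open>r \<in> X\<close> s(1), of r]) (use r s m in auto)
    then show False using r s by auto
  qed
  then show thesis using that l r by blast
qed

text \<open>Freeness supplies a shared vertex; with the shared third point this makes two common
  points, so the lines coincide.\<close>

lemma free_third_inj:
  assumes X: "X \<in> free_K5s K" and l: "{p, q, r} \<in> lines K" "p \<in> X" "q \<in> X" "p \<noteq> q"
    and m: "{p', q', r} \<in> lines K" "p' \<in> X" "q' \<in> X" "p' \<noteq> q'" and r: "r \<notin> X"
  shows "{p, q} = {p', q'}"
proof -
  have "{p, q} \<inter> {p', q'} \<noteq> {}"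
    by (rule free_common_vertex[OF X l(1) _ l(2-4) m(1) _ m(2-4), of r]) auto
  then obtain s where "s \<in> {p, q, r}" "s \<in> {p', q', r}" "s \<noteq> r" using l m r by blast
  then have "{p, q, r} = {p', q', r}" using lines_eqI[OF l(1) m(1), of s r] by blast
  then show ?thesis using l m r by blast
qed

lemma free_line_at:
  assumes X: "X \<in> free_K5s K" and p: "p \<in> X" and l: "l \<in> lines K" "p \<in> l"
  obtains q r where "q \<in> X" "q \<noteq> p" "r \<notin> X" "l = {p, q, r}"
proof -
  have "\<forall>q \<in> X - {p}. \<exists>r. {p, q, r} \<in> lines K \<and> r \<notin> X"
    using free_third[OF X p] by (metis Diff_iff insertI1)
  then obtain t where t: "\<And>q. q \<in> X - {p} \<Longrightarrow> {p, q, t q} \<in> lines K \<and> t q \<notin> X"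
    by metis
  have "(\<lambda>q. {p, q, t q}) ` (X - {p}) = {l \<in> lines K. p \<in> l}"
  proof (rule card_subset_eq)
    show "finite {l \<in> lines K. p \<in> l}" using finite_lines[OF conf] by simp
    show "(\<lambda>q. {p, q, t q}) ` (X - {p}) \<subseteq> {l \<in> lines K. p \<in> l}" using t by blast
    \<comment> \<open>A line determines its edge, since its third point is outside
      \<open>X\<close>.\<close>
    have "inj_on (\<lambda>q. {p, q, t q}) (X - {p})"
      using t by (intro inj_onI) (metis Diff_iff insertCI insertE singletonD)
    then have "card ((\<lambda>q. {p, q, t q}) ` (X - {p})) = 4"
      using p free_K5_card[OF X] by (simp add: card_image card_Diff_singleton)
    moreover have "card {l \<in> lines K. p \<in> l} = 4"
      using conf free_K5_subset[OF X] p unfolding configuration_def by blast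
    ultimately show "card ((\<lambda>q. {p, q, t q}) ` (X - {p})) = card {l \<in> lines K. p \<in> l}" by simp
  qed
  then obtain q where "q \<in> X - {p}" "l = {p, q, t q}" using l by blast
  then show thesis using that t[of q] by blast
qed

lemma free_other:
  assumes "X \<in> free_K5s K" "p \<in> X" "l \<in> lines K" "p \<in> l"
  obtains q where "q \<in> X" "q \<in> l" "q \<noteq> p"
  using free_line_at[OF assms] by blast

lemma free_edge_cover:
  assumes X: "X \<in> free_K5s K" and y: "y \<in> points K" "y \<notin> X"
  obtains p q where "p \<in> X" "q \<in> X" "p \<noteq> q" "{p, q, y} \<in> lines K"
proof -
  have "\<exists>r. insert r e \<in> lines K \<and> r \<notin> X" if e: "e \<in> pairs X" for e
  proof -
    obtain p q where pq: "e = {p, q}" "p \<in> X" "q \<in> X" "p \<noteq> q"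
      using e unfolding pairs_def by (auto simp: card_2_iff)
    then show ?thesis using free_third[OF X pq(2-4)] by (metis insert_commute)
  qed
  then obtain t where t: "\<And>e. e \<in> pairs X \<Longrightarrow> insert (t e) e \<in> lines K \<and> t e \<notin> X" by metis
  have "inj_on t (pairs X)"
  proof (rule inj_onI)
    fix e e' assume e: "e \<in> pairs X" and e': "e' \<in> pairs X" and "t e = t e'"
    obtain p q where pq: "e = {p, q}" "p \<in> X" "q \<in> X" "p \<noteq> q"
      using e unfolding pairs_def by (auto simp: card_2_iff)
    obtain p' q' where pq': "e' = {p', q'}" "p' \<in> X" "q' \<in> X" "p' \<noteq> q'"
      using e' unfolding pairs_def by (auto simp: card_2_iff)
    show "e = e'" unfolding pq(1) pq'(1)
      using t[OF e] t[OF e'] pq pq' \<open>t e = t e'\<close>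
      by (intro free_third_inj[OF X, of _ _ "t e"]) (auto simp: insert_commute)
  qed
  moreover have "card (pairs X) = 10"
    unfolding pairs_def n_subsets[OF free_K5_finite[OF X]] free_K5_card[OF X]
      by (simp add: numeral_eq_Suc)
  ultimately have "card (t ` pairs X) = 10" by (simp add: card_image)
  moreover have "card (points K - X) = 10" "finite (points K - X)"
    using conf free_K5_subset[OF X] free_K5_card[OF X] free_K5_finite[OF X]
    by (simp_all add: configuration_def card_Diff_subset)
  moreover have "t ` pairs X \<subseteq> points K - X" using t line_subset by blast
  ultimately have "t ` pairs X = points K - X" by (intro card_subset_eq) auto
  then obtain e where e: "e \<in> pairs X" "y = t e" using y by blast
  obtain p q where pq: "e = {p, q}" "p \<in> X" "q \<in> X" "p \<noteq> q"
    using e unfolding pairs_def by (auto simp: card_2_iff)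
  then show thesis using that[of p q] t[OF e(1)] e(2) by (simp add: insert_commute)
qed

lemma free_K5_Int:
  assumes X: "X \<in> free_K5s K" and Y: "Y \<in> free_K5s K" and "X \<noteq> Y"
  obtains p where "X \<inter> Y = {p}"
proof -
  have "\<not> Y \<subseteq> X"
    using \<open>X \<noteq> Y\<close> X Y free_K5_card free_K5_finite by (metis card_subset_eq)
  then obtain y where y: "y \<in> Y" "y \<notin> X" by blast
  have "X \<inter> Y \<noteq> {}"
  proof -
    \<comment> \<open>\<open>y\<close> is the third point of an edge of \<open>X\<close>. The line
      of that edge needs a second point in \<open>Y\<close>, which can only be an end of the
      edge.\<close>
    have "y \<in> points K" using free_K5_subset[OF Y] y by blast
    then obtain p q where pq: "p \<in> X" "q \<in> X" "{p, q, y} \<in> lines K"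
      using free_edge_cover[OF X] y by metis
    obtain z where "z \<in> Y" "z \<in> {p, q, y}" "z \<noteq> y"
      using free_other[OF Y y(1) pq(3)] by blast
    then show ?thesis using pq by blast
  qed
  moreover have "u = v" if u: "u \<in> X" "u \<in> Y" and v: "v \<in> X" "v \<in> Y" for u v
  proof (rule ccontr)
    assume "u \<noteq> v"
    \<comment> \<open>The line of the edge {w, y} of \<open>Y\<close> needs a second point in
      \<open>X\<close>. As \<open>y\<close> is not in \<open>X\<close>, its third point must
      be.\<close>
    have ex: "\<exists>x \<in> X. x \<noteq> w \<and> {w, x, y} \<in> lines K" if w: "w \<in> X" "w \<in> Y" for w
    proof -
      have "w \<noteq> y" using w y by blast
      then obtain r where r: "{w, y, r} \<in> lines K" "r \<notin> Y" using free_third[OF Y w(2) y(1)] by blast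
      obtain x where x: "x \<in> X" "x \<in> {w, y, r}" "x \<noteq> w" using free_other[OF X w(1) r(1)] by blast
      then have "x = r" using y by blast
      with x r show ?thesis by (metis insert_commute)
    qed
    obtain x x' where x: "x \<in> X" "x \<noteq> u" "{u, x, y} \<in> lines K"
      and x': "x' \<in> X" "x' \<noteq> v" "{v, x', y} \<in> lines K"
      using ex[OF u] ex[OF v] by blast
    \<comment> \<open>\<open>y\<close> is the third point of only one edge of \<open>X\<close>, so
      that edge is {u, v}. Then u, v, y are three points of \<open>Y\<close> on one line, which is
      impossible.\<close>
    have "{u, x} = {v, x'}" using free_third_inj[OF X x(3) u(1) x(1) _ x'(3) v(1) x'(1)] x x' y by blast
    then have "x = v" using \<open>u \<noteq> v\<close> by blast
    then have "{u, v, y} \<in> lines K" using x by simp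
    moreover obtain r where "{u, v, r} \<in> lines K" "r \<notin> Y" using free_third[OF Y u(2) v(2) \<open>u \<noteq> v\<close>] .
    ultimately have "{u, v, y} = {u, v, r}" using lines_eqI[of _ _ u v] \<open>u \<noteq> v\<close> by blast
    then have "y \<in> {u, v, r}" by blast
    then show False using \<open>r \<notin> Y\<close> u v y by auto
  qed
  ultimately show thesis using that by blast
qed

end

section \<open>Coordinates from three freely contained K_5\<close>

locale three_free_K5s = partial_steiner K for K :: "'p incidence" +
  fixes X :: "nat \<Rightarrow> 'p set"
  assumes free: "i \<in> idx \<Longrightarrow> X i \<in> free_K5s K" and inj_X: "inj_on X idx"
begin

text \<open>\<open>C {i, j}\<close> becomes the centre $q^{i,j}$, the triangle \<open>T i\<close> becomes $\{a_i, b_i, c_i\}$,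
  and \<open>Q\<close> becomes the line of the apices $q^a, q^b, q^c$.\<close>

definition C :: "nat set \<Rightarrow> 'p" where "C e = the_elem (\<Inter>i \<in> e. X i)"

definition T :: "nat \<Rightarrow> 'p set" where "T i = X i - (\<Union>j \<in> idx - {i}. X j)"

definition Q :: "'p set" where "Q = points K - (\<Union>i \<in> idx. X i)"

lemma Int_X:
  assumes "i \<in> idx" "j \<in> idx" "i \<noteq> j"
  shows "X i \<inter> X j = {C {i, j}}"
proof -
  have "X i \<noteq> X j" using inj_X assms by (auto dest: inj_onD)
  then obtain p where "X i \<inter> X j = {p}" using free_K5_Int[OF free free] assms by metis
  then show ?thesis by (simp add: C_def)
qed

lemma C_mem: "i \<in> idx \<Longrightarrow> j \<in> idx \<Longrightarrow> i \<noteq> j \<Longrightarrow> C {i, j} \<in> X i"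
  "i \<in> idx \<Longrightarrow> j \<in> idx \<Longrightarrow> i \<noteq> j \<Longrightarrow> C {i, j} \<in> X j"
  using Int_X[of i j] by blast+

lemma eq_C: "i \<in> idx \<Longrightarrow> j \<in> idx \<Longrightarrow> i \<noteq> j \<Longrightarrow> p \<in> X i \<Longrightarrow> p \<in> X j \<Longrightarrow> p = C {i, j}"
  using Int_X[of i j] by blast

lemma line_through_C:
  assumes ij: "i \<in> idx" "j \<in> idx" "i \<noteq> j" and l: "l \<in> lines K" "C {i, j} \<in> l"
  obtains x y where "x \<in> X i" "y \<in> X j" "x \<noteq> C {i, j}" "y \<noteq> C {i, j}" "l = {C {i, j}, x, y}"
proof -
  obtain x r where x: "x \<in> X i" "x \<noteq> C {i, j}" "r \<notin> X i" "l = {C {i, j}, x, r}"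
    using free_line_at[OF free[OF ij(1)] C_mem(1)[OF ij] l] .
  obtain y where y: "y \<in> X j" "y \<in> l" "y \<noteq> C {i, j}"
    using free_other[OF free[OF ij(2)] C_mem(2)[OF ij] l] .
  have "y \<noteq> x" using eq_C[OF ij, of x] x y by blast
  then have "y = r" using x y by blast
  then show thesis using that x y by blast
qed

text \<open>A line through a common point \<open>p\<close> would carry a further point of each of
  the three graphs. It has only two further points, so one of them would lie in two graphs, which
  already share \<open>p\<close>.\<close>

lemma Int3_X:
  assumes ijk: "i \<in> idx" "j \<in> idx" "k \<in> idx" "i \<noteq> j" "i \<noteq> k" "j \<noteq> k"
  shows "X i \<inter> X j \<inter> X k = {}"
proof (rule ccontr)
  assume "X i \<inter> X j \<inter> X k \<noteq> {}"
  then obtain p where p: "p \<in> X i" "p \<in> X j" "p \<in> X k" by blast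
  have c: "p = C {i, j}" "p = C {i, k}" "p = C {j, k}" using p eq_C ijk by blast+
  have "X i \<noteq> {p}" using free_K5_card[OF free[OF ijk(1)]] by auto
  then obtain q where q: "q \<in> X i" "q \<noteq> p" using p by blast
  obtain l where l: "l \<in> lines K" "{p, q} \<subseteq> l"
    using free_line[OF free[OF ijk(1)] p(1) q(1)] q by metis
  obtain x y where xy: "x \<in> X i" "y \<in> X j" "x \<noteq> p" "y \<noteq> p" "l = {p, x, y}"
    using line_through_C[OF ijk(1,2,4) l(1)] l(2) c by auto
  obtain z where z: "z \<in> X k" "z \<in> l" "z \<noteq> p"
    using free_other[OF free[OF ijk(3)] p(3) l(1)] l(2) by blast
  then have "z = x \<or> z = y" using xy by blast
  then show False using eq_C[OF ijk(1,3,5), of z] eq_C[OF ijk(2,3,6), of z] c xy z by auto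
qed

lemma C_neq:
  assumes ijk: "i \<in> idx" "j \<in> idx" "k \<in> idx" "i \<noteq> j" "i \<noteq> k" "j \<noteq> k"
  shows "C {i, j} \<noteq> C {i, k}" "C {i, j} \<notin> X k"
proof -
  show *: "C {i, j} \<notin> X k"
    using Int3_X[OF ijk] C_mem[OF ijk(1,2,4)] by blast
  show "C {i, j} \<noteq> C {i, k}"
    using * C_mem(2)[OF ijk(1,3,5)] by metis
qed

lemma C_inject:
  assumes ij: "i \<in> idx" "j \<in> idx" "i \<noteq> j" and kl: "k \<in> idx" "l \<in> idx" "k \<noteq> l"
    and eq: "C {i, j} = C {k, l}"
  shows "{i, j} = {k, l}"
proof -
  have "k \<in> {i, j}" using C_neq(2)[OF ij(1,2) kl(1) ij(3)] C_mem(1)[OF kl] eq by auto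
  moreover have "l \<in> {i, j}" using C_neq(2)[OF ij(1,2) kl(2) ij(3)] C_mem(2)[OF kl] eq by auto
  ultimately show ?thesis using kl(3) by auto
qed

text \<open>The line joining two of the intersection points, both in \<open>X i\<close>, needs a
  second point in \<open>X j\<close> and one in \<open>X k\<close>. Only its third point is
  available for either, so that point is the common point of \<open>X j\<close> and
  \<open>X k\<close>.\<close>

lemma axis_line:
  assumes ijk: "i \<in> idx" "j \<in> idx" "k \<in> idx" "i \<noteq> j" "i \<noteq> k" "j \<noteq> k"
  shows "{C {i, j}, C {i, k}, C {j, k}} \<in> lines K"
proof -
  have mem: "r \<in> X j" if l: "{C {i, j}, C {i, k}, r} \<in> lines K"
     and jk: "j \<in> idx" "k \<in> idx" "i \<noteq> j" "i \<noteq> k" "j \<noteq> k" for r j k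
  proof -
    obtain y where "y \<in> X j" "y \<in> {C {i, j}, C {i, k}, r}" "y \<noteq> C {i, j}"
      using free_other[OF free[OF jk(1)] C_mem(2)[OF ijk(1) jk(1,3)] l] by blast
    then show ?thesis using C_neq(2)[of i k j] jk ijk(1) by auto
  qed
  obtain r where r: "{C {i, j}, C {i, k}, r} \<in> lines K"
    using free_third[OF free[OF ijk(1)] C_mem(1)[OF ijk(1,2,4)] C_mem(1)[OF ijk(1,3,5)]
      C_neq(1)[OF ijk]] .
  then have "r \<in> X j" using mem ijk by blast
  moreover have "r \<in> X k" using mem[of k j r] r ijk by (simp add: insert_commute)
  ultimately show ?thesis using r eq_C ijk by blast
qed

lemma idx_third:
  assumes "i \<in> idx" "j \<in> idx" "i \<noteq> j"
  obtains k where "k \<in> idx" "k \<noteq> i" "k \<noteq> j" "idx = {i, j, k}"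
proof -
  have "\<exists>k \<in> idx. k \<noteq> i \<and> k \<noteq> j \<and> idx = {i, j, k}"
    using assms unfolding idx_def by (elim insertE emptyE) (simp_all add: insert_commute)
  then show thesis using that by blast
qed

lemma mem_T: "x \<in> T i \<longleftrightarrow> x \<in> X i \<and> (\<forall>j \<in> idx. j \<noteq> i \<longrightarrow> x \<notin> X j)"
  by (auto simp: T_def)

lemma finite_X: "i \<in> idx \<Longrightarrow> finite (X i)"
  using free free_K5_finite by blast

lemma card_X: "i \<in> idx \<Longrightarrow> card (X i) = 5"
  using free free_K5_card by blast

lemma card_T:
  assumes i: "i \<in> idx"
  shows "card (T i) = 3"
proof -
  obtain j where j: "j \<in> idx" "i \<noteq> j" by (metis idx_def insertCI n_not_Suc_n numeral_2_eq_2 One_nat_def)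
  obtain k where k: "k \<in> idx" "k \<noteq> i" "k \<noteq> j" "idx = {i, j, k}" using idx_third[OF i j] .
  have "T i = X i - (X i \<inter> X j \<union> X i \<inter> X k)" using k j by (auto simp: T_def)
  also have "\<dots> = X i - {C {i, j}, C {i, k}}"
    using Int_X[of i j] Int_X[of i k] i j k by blast
  finally show ?thesis
    using C_mem C_neq(1)[of i j k] i j k card_X[OF i] by (simp add: card_Diff_subset)
qed

text \<open>Inclusion-exclusion: three graphs of 5 points, three pairwise common points and no
  triple one cover 12 of the 15 points.\<close>

lemma card_Q: "card Q = 3"
proof -
  have i: "1 \<in> idx" "2 \<in> idx" "3 \<in> idx" by (simp_all add: idx_def)
  have "card (X 1 \<union> X 2) = 9"
    using card_Un_Int[OF finite_X[OF i(1)] finite_X[OF i(2)]] card_X i Int_X[OF i(1,2)] by simp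
  moreover have "(X 1 \<union> X 2) \<inter> X 3 = {C {1, 3}, C {2, 3}}"
    using Int_X[OF i(1,3)] Int_X[OF i(2,3)] by auto
  then have "card ((X 1 \<union> X 2) \<inter> X 3) = 2"
    using C_neq(1)[OF i(3,1,2)] by (simp add: insert_commute)
  ultimately have "card (X 1 \<union> X 2 \<union> X 3) = 12"
    using card_Un_Int[of "X 1 \<union> X 2" "X 3"] card_X[OF i(3)] finite_X i by simp
  moreover have "X 1 \<union> X 2 \<union> X 3 \<subseteq> points K" using free_K5_subset free i by blast
  moreover have "Q = points K - (X 1 \<union> X 2 \<union> X 3)" by (auto simp: Q_def idx_def)
  ultimately show ?thesis
    using conf finite_X i by (simp add: card_Diff_subset configuration_def)
qed

text \<open>If \<open>r\<close> were in another \<open>X j\<close>, the line would need a second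
  point there, but \<open>x\<close> and \<open>y\<close> belong to \<open>X i\<close> only.\<close>

lemma third_in_Q:
  assumes i: "i \<in> idx" and xy: "x \<in> T i" "y \<in> T i" "x \<noteq> y" and l: "{x, y, r} \<in> lines K" and r: "r \<notin> X i"
  shows "r \<in> Q"
proof -
  have "r \<notin> X j" if j: "j \<in> idx" for j
  proof
    assume "r \<in> X j"
    then obtain q where "q \<in> X j" "q \<in> {x, y, r}" "q \<noteq> r"
      using free_other[OF free[OF j] _ l] by blast
    then show False using xy j r \<open>r \<in> X j\<close> unfolding mem_T by auto
  qed
  then show ?thesis using line_subset[OF l] by (auto simp: Q_def)
qed

text \<open>Sending a vertex of the triangle to the third point of the opposite side is an injection
  between two sets of 3 elements, hence a bijection onto \<open>Q\<close>. Its inverse carries the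
  labelling \<open>A\<close> of \<open>Q\<close> over to the triangle.\<close>

lemma opposite_vertices:
  assumes i: "i \<in> idx" and A: "bij_betw A (UNIV :: letter set) Q"
  shows "\<exists>V. inj V \<and> range V = T i \<and> (\<forall>u. insert (A u) (V ` (- {u})) \<in> lines K)"
proof -
  have T_X: "T i \<subseteq> X i" by (auto simp: T_def)
  have fin: "finite (T i)" using card_T[OF i] card.infinite by fastforce
  have edge: "\<exists>y z. T i - {x} = {y, z} \<and> y \<noteq> z \<and> y \<in> T i \<and> z \<in> T i" if "x \<in> T i" for x
  proof -
    have "card (T i - {x}) = 2" using that card_T[OF i] by (simp add: card_Diff_singleton)
    then show ?thesis unfolding card_2_iff by blast
  qed
  have "\<exists>r. insert r (T i - {x}) \<in> lines K \<and> r \<in> Q" if x: "x \<in> T i" for x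
  proof -
    obtain y z where yz: "T i - {x} = {y, z}" "y \<noteq> z" "y \<in> T i" "z \<in> T i" using edge[OF x] by blast
    obtain r where r: "{y, z, r} \<in> lines K" "r \<notin> X i"
      using free_third[OF free[OF i], of y z] yz T_X by blast
    have "r \<in> Q" by (rule third_in_Q[OF i yz(3,4,2) r])
    moreover have "insert r (T i - {x}) = {y, z, r}" unfolding yz(1) by blast
    ultimately show ?thesis using r by metis
  qed
  then obtain f where f: "\<And>x. x \<in> T i \<Longrightarrow> insert (f x) (T i - {x}) \<in> lines K \<and> f x \<in> Q" by metis
  have "inj_on f (T i)"
  proof (rule inj_onI)
    fix x x' assume x: "x \<in> T i" and x': "x' \<in> T i" and eq: "f x = f x'"
    obtain y z where yz: "T i - {x} = {y, z}" "y \<noteq> z" "y \<in> T i" "z \<in> T i" using edge[OF x] by blast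
    obtain y' z' where yz': "T i - {x'} = {y', z'}" "y' \<noteq> z'" "y' \<in> T i" "z' \<in> T i"
      using edge[OF x'] by blast
    have "{y, z} = {y', z'}"
    proof (rule free_third_inj[OF free[OF i]])
      show "{y, z, f x} \<in> lines K" "{y', z', f x} \<in> lines K"
        using f[OF x] f[OF x'] yz(1) yz'(1) eq by (simp_all add: insert_commute)
      show "f x \<notin> X i" using f[OF x] i by (auto simp: Q_def)
    qed (use yz yz' T_X in auto)
    then have "T i - {x} = T i - {x'}" using yz yz' by simp
    then show "x = x'" using x x' by blast
  qed
  moreover have "f ` T i = Q"
  proof (rule card_subset_eq)
    show "finite Q" using card_Q card.infinite by fastforce
    show "f ` T i \<subseteq> Q" using f by blast
    show "card (f ` T i) = card Q" using calculation card_T[OF i] card_Q by (simp add: card_image)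
  qed
  ultimately have bij: "bij_betw f (T i) Q" by (simp add: bij_betw_def)
  define V where "V = inv_into (T i) f \<circ> A"
  have V: "bij_betw V UNIV (T i)"
    unfolding V_def by (rule bij_betw_trans[OF A bij_betw_inv_into[OF bij]])
  have "insert (A u) (V ` (- {u})) \<in> lines K" for u
  proof -
    have "A u \<in> Q" using A by (auto simp: bij_betw_def)
    then have "f (V u) = A u" using bij by (simp add: V_def bij_betw_def f_inv_into_f)
    moreover have "V u \<in> T i" using V by (auto simp: bij_betw_def)
    moreover have "V ` (- {u}) = T i - {V u}"
      using V by (auto simp: bij_betw_def inj_eq)
    ultimately show ?thesis using f[of "V u"] by simp
  qed
  then show ?thesis using V by (auto simp: bij_betw_def)
qed

text \<open>The third point of the line lies in \<open>X j\<close>, the graph that needs a second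
  point on it. If it were also in \<open>X k\<close>, it would be \<open>C {j, k}\<close> and the
  line would be the axis, which contains no point of \<open>T i\<close>.\<close>

lemma ray_ex:
  assumes ij: "i \<in> idx" "j \<in> idx" "i \<noteq> j" and x: "x \<in> T i"
  shows "\<exists>y \<in> T j. {C {i, j}, x, y} \<in> lines K"
proof -
  have xX: "x \<in> X i" "x \<notin> X j" "x \<noteq> C {i, j}" using x C_mem(2)[OF ij] ij unfolding mem_T by auto
  obtain r where r: "{C {i, j}, x, r} \<in> lines K" "r \<notin> X i"
    using free_third[OF free[OF ij(1)] C_mem(1)[OF ij] xX(1) xX(3)[symmetric]] .
  obtain y where y: "y \<in> X j" "y \<in> {C {i, j}, x, r}" "y \<noteq> C {i, j}"
    using free_other[OF free[OF ij(2)] C_mem(2)[OF ij] r(1)] by blast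
  then have "r \<in> X j" using xX by auto
  obtain k where k: "k \<in> idx" "k \<noteq> i" "k \<noteq> j" "idx = {i, j, k}" using idx_third[OF ij] .
  have "r \<notin> X k"
  proof
    assume "r \<in> X k"
    then have "r = C {j, k}" using eq_C \<open>r \<in> X j\<close> ij k by blast
    moreover have "{C {i, j}, C {i, k}, C {j, k}} \<in> lines K" using axis_line ij k by blast
    moreover have "C {j, k} \<noteq> C {i, j}" using C_neq(1)[of j k i] ij k by (simp add: insert_commute)
    ultimately have "{C {i, j}, x, r} = {C {i, j}, C {i, k}, C {j, k}}"
      using lines_eqI[OF r(1), of _ "C {i, j}" r] by simp
    then have "x \<in> {C {i, j}, C {i, k}, C {j, k}}" by blast
    then show False using x C_mem[of i j] C_mem[of i k] C_mem[of j k] ij k unfolding mem_T by auto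
  qed
  then have "r \<in> T j" using \<open>r \<in> X j\<close> r k(4) unfolding mem_T by auto
  then show ?thesis using r by blast
qed

text \<open>At most three of the four lines through a point \<open>q\<close> of \<open>Q\<close> are
  sides of triangles opposite to the letter of \<open>q\<close>, so a line \<open>m\<close> is left
  over. A point of \<open>m\<close> in some \<open>X i\<close> would bring a second one, and
  \<open>m\<close> would be such a side after all. Hence \<open>m\<close> lies inside
  \<open>Q\<close>, and both have 3 points.\<close>

lemma Q_line:
  assumes A: "bij_betw A (UNIV :: letter set) Q"
    and V: "\<And>i. i \<in> idx \<Longrightarrow> inj (V i) \<and> range (V i) = T i \<and> (\<forall>u. insert (A u) (V i ` (- {u})) \<in> lines K)"
  shows "Q \<in> lines K"
proof -
  define q where "q = A La"
  have q: "q \<in> Q" using A by (auto simp: q_def bij_betw_def)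
  let ?S = "(\<lambda>i. insert q (V i ` (- {La}))) ` idx"
  have deg: "card {l \<in> lines K. q \<in> l} = 4" using conf q by (simp add: configuration_def Q_def)
  moreover have "card ?S \<le> 3" using card_image_le[of idx "\<lambda>i. insert q (V i ` (- {La}))"]
    by (simp add: idx_def)
  moreover have "finite ?S" by (simp add: idx_def)
  ultimately have "\<not> {l \<in> lines K. q \<in> l} \<subseteq> ?S" using card_mono[of ?S "{l \<in> lines K. q \<in> l}"] by auto
  then obtain m where m: "m \<in> lines K" "q \<in> m" "m \<notin> ?S" by blast
  have "m \<inter> X i = {}" if i: "i \<in> idx" for i
  proof (rule ccontr)
    assume "m \<inter> X i \<noteq> {}"
    then obtain x where x: "x \<in> m" "x \<in> X i" by blast
    obtain x' where x': "x' \<in> X i" "x' \<in> m" "x' \<noteq> x" using free_other[OF free[OF i] x(2) m(1) x(1)] .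
    have qX: "q \<notin> X j" if "j \<in> idx" for j using q that by (auto simp: Q_def)
    obtain r where "m = {x, x', r}" using line_third[OF m(1) x(1) x'(2)] x'(3) by metis
    then have mq: "m = {x, x', q}" using m(2) qX[OF i] x x' by auto
    \<comment> \<open>If one of the two points were also in \<open>X j\<close>, so would be the
      other, and \<open>X i\<close> and \<open>X j\<close> would share both.\<close>
    have inT: "y \<in> T i" if y: "y \<in> {x, x'}" for y
      unfolding mem_T
    proof (intro conjI ballI impI notI)
      show "y \<in> X i" using y x x' by blast
      fix j assume j: "j \<in> idx" "j \<noteq> i" "y \<in> X j"
      obtain y' where y': "y' \<in> X j" "y' \<in> m" "y' \<noteq> y" using free_other[OF free[OF j(1)] j(3) m(1)]
        y x x' by blast
      then have "y' \<in> X i" using mq qX[OF j(1)] x x' by auto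
      then show False using eq_C[OF i j(1), of y] eq_C[OF i j(1), of y'] y' j \<open>y \<in> X i\<close> by auto
    qed
    obtain v w where vw: "x = V i v" "x' = V i w" using inT V[OF i] by (metis insertI1 insertI2 rangeE)
    have "v \<noteq> w" using vw x' by blast
    let ?l = "insert (A (third_letter v w)) (V i ` (- {third_letter v w}))"
    have l: "?l \<in> lines K" using V[OF i] by blast
    have "x \<in> ?l" "x' \<in> ?l" using vw third_letter_neq[OF \<open>v \<noteq> w\<close>] by auto
    then have ml: "m = ?l" using lines_eqI[OF m(1) l x(1) _ x'(2)] x'(3) by blast
    have "q \<notin> range (V i)" using V[OF i] qX[OF i] by (auto simp: mem_T)
    then have "q = A (third_letter v w)" using ml m(2) by auto
    then have "third_letter v w = La" using A by (auto simp: q_def bij_betw_def inj_eq)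
    then have "m = insert q (V i ` (- {La}))" using ml by (simp add: q_def)
    then show False using m(3) i by blast
  qed
  then have "m \<subseteq> Q" using line_subset[OF m(1)] by (auto simp: Q_def)
  moreover have "card m = card Q" using conf m(1) card_Q by (simp add: configuration_def)
  moreover have "finite Q" using card_Q card.infinite by fastforce
  ultimately show ?thesis using card_subset_eq m(1) by metis
qed

theorem isomorphic_TP: "\<exists>\<xi>. perspective_system \<xi> \<and> isomorphic K (TP \<xi>)"
proof -
  have "finite Q" using card_Q card.infinite by fastforce
  \<comment> \<open>Any labelling of \<open>Q\<close> will do; the sides transfer it to the three
    triangles.\<close>
  then obtain A where A: "bij_betw A (UNIV :: letter set) Q"
    using finite_same_card_bij[of "UNIV :: letter set" Q] card_Q by (auto simp: UNIV_letter)
  obtain V where V: "\<And>i. i \<in> idx \<Longrightarrow> inj (V i) \<and> range (V i) = T i \<and> (\<forall>u. insert (A u) (V i ` (- {u}))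
    \<in> lines K)"
    using opposite_vertices[OF _ A] by metis
  have VT: "V i u \<in> T i" if "i \<in> idx" for i u using V[OF that] by blast
  have "\<exists>v. {C {i, j}, V i u, V j v} \<in> lines K" if ij: "i \<in> idx" "j \<in> idx" "i \<noteq> j" for i j u
  proof -
    obtain y where "y \<in> T j" "{C {i, j}, V i u, y} \<in> lines K"
      using ray_ex[OF ij VT[OF ij(1), of u]] by blast
    moreover have "y \<in> range (V j)" using V[OF ij(2)] calculation(1) by simp
    ultimately show ?thesis by auto
  qed
  then obtain g where g: "\<And>i j u. i \<in> idx \<Longrightarrow> j \<in> idx \<Longrightarrow> i \<noteq> j \<Longrightarrow> {C {i, j}, V i u, V j (g i j u)} \<in>
    lines K"
    by metis
  define \<xi> where "\<xi> i j = (if i = j then id else g i j)" for i j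
  \<comment> \<open>The line through \<open>C {i, j}\<close> and \<open>V i u\<close> is unique, so
    the lines determine \<open>g\<close>; reading the line from its other end gives
    \<open>inverse\<close>.\<close>
  have uniq: "v = g i j u" if ij: "i \<in> idx" "j \<in> idx" "i \<noteq> j"
    and l: "{C {i, j}, V i u, V j v} \<in> lines K" for i j u v
  proof -
    have "V i u \<noteq> C {i, j}" "V j v \<noteq> C {i, j}" "V j v \<noteq> V i u"
      using VT[OF ij(1), of u] VT[OF ij(2), of v] C_mem[OF ij] ij unfolding mem_T by auto
    moreover have "{C {i, j}, V i u, V j v} = {C {i, j}, V i u, V j (g i j u)}"
      using lines_eqI[OF l g[OF ij, of u], of "C {i, j}" "V i u"] calculation by simp
    ultimately have "V j v = V j (g i j u)" by blast
    then show ?thesis using V[OF ij(2)] by (simp add: inj_eq)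
  qed
  have inverse: "g j i (g i j u) = u" if ij: "i \<in> idx" "j \<in> idx" "i \<noteq> j" for i j u
    using uniq[OF ij(2,1), of "g i j u" u] g[OF ij, of u] ij(3) by (simp add: insert_commute)
  have \<xi>: "perspective_system \<xi>"
    unfolding perspective_system_def
  proof (intro conjI ballI)
    fix i j assume ij: "i \<in> idx" "j \<in> idx"
    have *: "\<xi> j i \<circ> \<xi> i j = id" "\<xi> i j \<circ> \<xi> j i = id"
      using inverse[OF ij] inverse[OF ij(2,1)] by (auto simp: \<xi>_def fun_eq_iff)
    show "bij (\<xi> i j)" using * by (rule o_bij)
    show "\<xi> j i = inv (\<xi> i j)" using inv_unique_comp[OF *(2,1)] by simp
  qed (simp add: \<xi>_def)
  define F where "F p = (case p of Apex u \<Rightarrow> A u | Vertex u i \<Rightarrow> V i u | Centre e \<Rightarrow> C e)" for p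
  have A_Q: "A u \<in> Q" for u using A by (auto simp: bij_betw_def)
  have X_K: "X i \<subseteq> points K" if "i \<in> idx" for i using free_K5_subset[OF free[OF that]] .
  \<comment> \<open>The map goes from \<open>TP \<xi>\<close> to \<open>K\<close>, where
    \<open>F\<close> is definable by the kind of the point, and is inverted afterwards.\<close>
  have "isomorphic (TP \<xi>) K"
  proof (rule isomorphicI[OF configuration_TP[OF \<xi>] conf])
    show "F ` points (TP \<xi>) \<subseteq> points K"
      using A_Q VT C_mem(1) X_K unfolding points_TP F_def Q_def mem_T by (auto; blast)
    define E where "E = {{j, k} | j k. j \<in> idx \<and> k \<in> idx \<and> j \<noteq> k}"
    have AV: "A u \<noteq> V i v" if "i \<in> idx" for u i v
      using A_Q[of u] VT[OF that, of v] that by (auto simp: Q_def mem_T)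
    have AC: "A u \<noteq> C e" if e: "e \<in> E" for u e
    proof -
      obtain j k where jk: "e = {j, k}" "j \<in> idx" "k \<in> idx" "j \<noteq> k"
        using e unfolding E_def by blast
      show ?thesis using A_Q[of u] C_mem(1)[OF jk(2-4)] jk by (auto simp: Q_def)
    qed
    have VC: "V i v \<noteq> C e" if i: "i \<in> idx" and "e \<in> E" for i v e
    proof -
      obtain j k where jk: "e = {j, k}" "j \<in> idx" "k \<in> idx" "j \<noteq> k"
        using \<open>e \<in> E\<close> unfolding E_def by blast
      show ?thesis
        using VT[OF i, of v] C_mem[OF jk(2-4)] jk by (cases "j = i") (auto simp: mem_T)
    qed
    have CC: "C e = C e' \<longleftrightarrow> e = e'" if e: "e \<in> E" "e' \<in> E" for e e'
    proof -
      obtain i j k l where "e = {i, j}" "i \<in> idx" "j \<in> idx" "i \<noteq> j" "e' = {k, l}" "k \<in> idx"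
        "l \<in> idx" "k \<noteq> l"
        using e unfolding E_def by (elim CollectE exE conjE)
      then show ?thesis using C_inject[of i j k l] by blast
    qed
    have VV: "V i u = V j v \<longleftrightarrow> i = j \<and> u = v" if "i \<in> idx" "j \<in> idx" for i j u v
      using VT[OF that(1), of u] VT[OF that(2), of v] V[OF that(1)] that by (auto simp: mem_T inj_eq)
    have AA: "A u = A v \<longleftrightarrow> u = v" for u v using A by (auto simp: bij_betw_def inj_eq)
    have "points (TP \<xi>) \<subseteq> range Apex \<union> {Vertex u i | u i. i \<in> idx} \<union> Centre ` E"
      unfolding points_TP E_def by blast
    moreover have "inj_on F (range Apex \<union> {Vertex u i | u i. i \<in> idx} \<union> Centre ` E)"
    proof (rule inj_onI)
      fix p q assume "p \<in> range Apex \<union> {Vertex u i | u i. i \<in> idx} \<union> Centre ` E"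
        "q \<in> range Apex \<union> {Vertex u i | u i. i \<in> idx} \<union> Centre ` E" "F p = F q"
      then show "p = q"
        by (cases p; cases q; auto simp: F_def AV AC VC CC VV AA AV[symmetric] AC[symmetric]
          VC[symmetric])
    qed
    ultimately show "inj_on F (points (TP \<xi>))" by (meson inj_on_subset)
    fix l assume "l \<in> lines (TP \<xi>)"
    then consider "l = range Apex" | "l = axis" | u i where "i \<in> idx" "l = side u i"
      | i j u where "i \<in> idx" "j \<in> idx" "i \<noteq> j" "l = ray \<xi> i j u"
      unfolding lines_TP by blast
    then show "F ` l \<in> lines K"
    proof cases
      case 1
      have "F ` l = Q" using A unfolding 1 by (auto simp: F_def bij_betw_def image_image)
      then show ?thesis using Q_line[OF A V] by simp
    next
      case 2
      then show ?thesis using axis_line[of 1 2 3] by (simp add: axis_def F_def idx_def)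
    next
      case 3
      then show ?thesis using V[of i] by (simp add: side_def F_def image_image)
    next
      case 4
      then show ?thesis using g[of i j u] by (simp add: ray_def F_def \<xi>_def)
    qed
  qed
  then have "isomorphic K (TP \<xi>)"
    by (rule isomorphic_sym) (rule configuration_line_subset[OF configuration_TP[OF \<xi>]])
  then show ?thesis using \<xi> by (intro exI conjI)
qed
end

section \<open>Relabelling systems of triangle perspectives\<close>

text \<open>\<open>\<pi>\<close> = \<open>id\<close> gives simultaneous conjugation by
  \<open>\<alpha>\<close>, and \<open>\<alpha>\<close> = \<open>id\<close> gives a renumbering of
  the triangles. Injectivity of \<open>\<pi>\<close> beyond \<open>idx\<close> makes
  \<open>F\<close> injective on the whole type.\<close>

lemma isomorphic_relabel:
  assumes \<xi>: "perspective_system \<xi>" and \<xi>': "perspective_system \<xi>'"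
    and \<alpha>: "bij \<alpha>" and \<pi>: "inj \<pi>" "\<pi> ` idx \<subseteq> idx"
    and rel: "\<And>i j u. i \<in> idx \<Longrightarrow> j \<in> idx \<Longrightarrow> i \<noteq> j \<Longrightarrow> \<xi>' (\<pi> i) (\<pi> j) (\<alpha> u) = \<alpha> (\<xi> i j u)"
  shows "isomorphic (TP \<xi>) (TP \<xi>')"
proof -
  define F where "F p = (case p of Apex u \<Rightarrow> Apex (\<alpha> u) | Vertex u i \<Rightarrow> Vertex (\<alpha> u) (\<pi> i)
    | Centre e \<Rightarrow> Centre (\<pi> ` e))" for p
  have F [simp]: "F (Apex u) = Apex (\<alpha> u)" "F (Vertex u i) = Vertex (\<alpha> u) (\<pi> i)"
    "F (Centre e) = Centre (\<pi> ` e)"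
    for u i e by (simp_all add: F_def)
  have \<pi>_idx: "\<pi> i \<in> idx" if "i \<in> idx" for i using \<pi>(2) that by blast
  have \<pi>_neq: "\<pi> i \<noteq> \<pi> j" if "i \<noteq> j" for i j using \<pi>(1) that by (simp add: inj_eq)
  have inj: "inj F"
  proof (rule injI)
    fix p q assume "F p = F q"
    then show "p = q"
      by (cases p; cases q; simp add: bij_is_inj[OF \<alpha>] \<pi>(1) inj_eq inj_image_eq_iff)
  qed
  have axis: "F ` axis = axis"
  proof (rule card_subset_eq)
    show "finite axis" by (simp add: axis_def)
    show "F ` axis \<subseteq> axis"
    proof
      fix p assume "p \<in> F ` axis"
      then obtain i j where "p = Centre {\<pi> i, \<pi> j}" "i \<in> idx" "j \<in> idx" "i \<noteq> j"
        unfolding Centre_idx[symmetric] by auto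
      then show "p \<in> axis" using mem_axis(3)[of "\<pi> i" "\<pi> j"] \<pi>_idx \<pi>_neq by simp
    qed
    show "card (F ` axis) = card axis" using inj by (simp add: card_image inj_on_subset)
  qed
  show ?thesis
  proof (rule isomorphicI[OF configuration_TP[OF \<xi>] configuration_TP[OF \<xi>']])
    show "inj_on F (points (TP \<xi>))" using inj by (rule inj_on_subset) simp
    show "F ` points (TP \<xi>) \<subseteq> points (TP \<xi>')"
      using axis \<pi>_idx unfolding points_TP Centre_idx by (auto; blast)
    fix l assume "l \<in> lines (TP \<xi>)"
    then consider "l = range Apex" | "l = axis" | u i where "i \<in> idx" "l = side u i"
      | i j u where "i \<in> idx" "j \<in> idx" "i \<noteq> j" "l = ray \<xi> i j u"
      unfolding lines_TP by blast
    then show "F ` l \<in> lines (TP \<xi>')"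
    proof cases
      case 1
      have "F ` l = Apex ` range \<alpha>" unfolding 1 by (simp add: image_image)
      then show ?thesis using \<alpha> by (simp add: bij_is_surj lines_TP)
    next
      case 2
      then show ?thesis by (simp add: axis lines_TP)
    next
      case (3 u i)
      have "F ` l = insert (Apex (\<alpha> u)) ((\<lambda>v. Vertex v (\<pi> i)) ` \<alpha> ` (- {u}))"
        unfolding 3 side_def by (simp add: image_image)
      also have "\<alpha> ` (- {u}) = - {\<alpha> u}" using \<alpha> by (simp add: bij_image_Compl_eq)
      finally have "F ` l = side (\<alpha> u) (\<pi> i)" by (simp add: side_def)
      then show ?thesis using \<pi>_idx 3 unfolding lines_TP by blast
    next
      case (4 i j u)
      have "F ` l = ray \<xi>' (\<pi> i) (\<pi> j) (\<alpha> u)"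
        using 4 rel[of i j u] by (simp add: ray_def)
      then show ?thesis using \<pi>_idx \<pi>_neq 4 unfolding lines_TP by blast
    qed
  qed
qed

text \<open>Codes for the elements of $S_{\mathscr T}$, on which inversion and conjugation are computable.\<close>

datatype perm3 = Id3 | Rot | Rot' | Refl letter

primrec fn :: "perm3 \<Rightarrow> letter \<Rightarrow> letter" where
  "fn Id3 u = u"
| "fn Rot u = rho u"
| "fn Rot' u = rho (rho u)"
| "fn (Refl x) u = sigma x u"

primrec perm3_inv :: "perm3 \<Rightarrow> perm3" where
  "perm3_inv Id3 = Id3" | "perm3_inv Rot = Rot'" | "perm3_inv Rot' = Rot" |
    "perm3_inv (Refl x) = Refl x"

text \<open>The code of a s a^{-1}: a reflection inverts rotations, and the reflection fixing x
  becomes the one fixing a(x).\<close>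

primrec perm3_conj :: "perm3 \<Rightarrow> perm3 \<Rightarrow> perm3" where
  "perm3_conj a Id3 = Id3"
| "perm3_conj a Rot = (case a of Refl _ \<Rightarrow> Rot' | _ \<Rightarrow> Rot)"
| "perm3_conj a Rot' = (case a of Refl _ \<Rightarrow> Rot | _ \<Rightarrow> Rot')"
| "perm3_conj a (Refl x) = Refl (fn a x)"

lemma rho_rho_rho [simp]: "rho (rho (rho u)) = u"
  by (cases u) simp_all

lemma fn_perm3_inv [simp]: "fn (perm3_inv s) (fn s u) = u" "fn s (fn (perm3_inv s) u) = u"
proof -
  have "sigma x (sigma x u) = u" for x by (cases x) simp_all
  then show "fn (perm3_inv s) (fn s u) = u" "fn s (fn (perm3_inv s) u) = u"
    by (cases s; simp)+
qed

lemma bij_fn: "bij (fn s)"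
  by (rule o_bij[of "fn (perm3_inv s)"]) (simp_all add: fun_eq_iff)

lemma inv_fn: "inv (fn s) = fn (perm3_inv s)"
  by (rule inv_unique_comp) (simp_all add: fun_eq_iff)

lemma fn_simps: "fn Id3 = id" "fn Rot = rho" "fn Rot' = inv rho" "fn (Refl x) = sigma x"
proof -
  show rot: "fn Rot = rho" by (simp add: fun_eq_iff)
  show "fn Rot' = inv rho" using inv_fn[of Rot] by (simp add: rot)
qed (simp_all add: fun_eq_iff)

lemma perm3_inv_inv [simp]: "perm3_inv (perm3_inv s) = s"
  by (cases s) simp_all

lemma perm3_inv_conj [simp]: "perm3_inv (perm3_conj a s) = perm3_conj a (perm3_inv s)"
  by (cases s; cases a) simp_all

text \<open>Conjugation written as (a s a^{-1}) a = a s, the form of the premise \<open>rel\<close>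
  of \<open>isomorphic_relabel\<close>.\<close>

lemma fn_perm3_conj [simp]: "fn (perm3_conj a s) (fn a u) = fn a (fn s u)"
proof -
  have rot: "rho (sigma x v) = sigma x (rho (rho v))" "sigma (rho x) (rho v) = rho (sigma x v)"
     "sigma (sigma y x) (sigma y v) = sigma y (sigma x v)" for x y v
    by ((cases x; cases v; simp add: transpose_def), (cases x; cases v; simp add: transpose_def),
      (cases x; cases y; cases v; simp add: transpose_def))
  show ?thesis by (cases s; cases a) (simp_all add: rot)
qed

lemma ex_perm3: "(\<exists>s. P s) \<longleftrightarrow> P Id3 \<or> P Rot \<or> P Rot' \<or> P (Refl La) \<or> P (Refl Lb) \<or> P (Refl Lc)"
proof
  assume "\<exists>s. P s"
  then obtain s where "P s" ..
  then show "P Id3 \<or> P Rot \<or> P Rot' \<or> P (Refl La) \<or> P (Refl Lb) \<or> P (Refl Lc)"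
  proof (cases s)
    case (Refl x)
    with \<open>P s\<close> show ?thesis by (cases x) simp_all
  qed simp_all
qed blast

lemma bij_letter:
  assumes "bij f"
  shows "\<exists>s. f = fn s"
proof -
  have "f La \<noteq> f Lb" "f La \<noteq> f Lc" "f Lb \<noteq> f Lc"
    using assms by (simp_all add: bij_is_inj inj_eq)
  then show ?thesis
    unfolding ex_perm3 fun_eq_iff all_letter
    by (cases "f La"; cases "f Lb"; cases "f Lc"; simp)
qed

section \<open>Orbits of triples under conjugation and renumbering\<close>

type_synonym triple = "perm3 \<times> perm3 \<times> perm3"

fun xi3 :: "triple \<Rightarrow> nat \<Rightarrow> nat \<Rightarrow> letter \<Rightarrow> letter" where
  "xi3 (f, g, h) = xi_of (fn f, fn g, fn h)"

lemma perspective_system_xi3: "perspective_system (xi3 t)"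
  by (cases t) (simp add: perspective_system_xi_of bij_fn)

fun conj3 :: "perm3 \<Rightarrow> triple \<Rightarrow> triple" where
  "conj3 a (f, g, h) = (perm3_conj a f, perm3_conj a g, perm3_conj a h)"

text \<open>The effect of renumbering 1, 2, 3 as 3, 1, 2; an entry is inverted where its two indices
  change their order. With \<open>swap3\<close>, which exchanges 1 and 2, it generates all
  renumberings.\<close>

fun cycle3 :: "triple \<Rightarrow> triple" where
  "cycle3 (f, g, h) = (g, perm3_inv h, perm3_inv f)"

fun swap3 :: "triple \<Rightarrow> triple" where
  "swap3 (f, g, h) = (perm3_inv f, h, g)"

lemma isomorphic_conj3: "isomorphic (TP (xi3 t)) (TP (xi3 (conj3 a t)))"
  by (cases t, rule isomorphic_relabel[where \<alpha> = "fn a" and \<pi> = id, OF perspective_system_xi3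
    perspective_system_xi3 bij_fn])
    (auto simp: xi_of_def inv_fn)

lemma isomorphic_cycle3: "isomorphic (TP (xi3 t)) (TP (xi3 (cycle3 t)))"
  by (cases t, rule isomorphic_relabel[where \<alpha> = id and \<pi> = "transpose 2 3 \<circ> transpose 1 2",
        OF perspective_system_xi3 perspective_system_xi3 bij_id])
    (auto simp: xi_of_def inv_fn idx_def transpose_def inj_compose)

lemma isomorphic_swap3: "isomorphic (TP (xi3 t)) (TP (xi3 (swap3 t)))"
  by (cases t, rule isomorphic_relabel[where \<alpha> = id and \<pi> = "transpose 1 2",
        OF perspective_system_xi3 perspective_system_xi3 bij_id])
    (auto simp: xi_of_def inv_fn idx_def transpose_def)

definition perm3s :: "perm3 list" where
  "perm3s = [Id3, Rot, Rot', Refl La, Refl Lb, Refl Lc]"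

lemma set_perm3s: "s \<in> set perm3s"
  unfolding perm3s_def using ex_perm3[of "\<lambda>t. s = t"] by simp

definition reindexings :: "triple \<Rightarrow> triple list" where
  "reindexings t =
     [t, cycle3 t, cycle3 (cycle3 t), swap3 t, cycle3 (swap3 t), cycle3 (cycle3 (swap3 t))]"

text \<open>Conjugation commutes with renumbering, so these 36 images, repetitions included, form
  the full orbit under S_3 x S_3.\<close>

definition orbit3 :: "triple \<Rightarrow> triple list" where
  "orbit3 t = concat (map (\<lambda>s. map (\<lambda>a. conj3 a s) perm3s) (reindexings t))"

lemma isomorphic_orbit3:
  assumes "t' \<in> set (orbit3 t)"
  shows "isomorphic (TP (xi3 t)) (TP (xi3 t'))"
proof -
  have "\<exists>s \<in> set (reindexings t). \<exists>a \<in> set perm3s. t' = conj3 a s"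
    using assms by (simp add: orbit3_def image_iff)
  then obtain s a where s: "s \<in> set (reindexings t)" and t': "t' = conj3 a s" by (elim bexE)
  have "s = t \<or> isomorphic (TP (xi3 t)) (TP (xi3 s))"
    using s unfolding reindexings_def list.set
    by (elim insertE emptyE)
      (simp_all add: isomorphic_swap3 isomorphic_cycle3 isomorphic_trans[OF isomorphic_cycle3
        isomorphic_cycle3]
        isomorphic_trans[OF isomorphic_swap3 isomorphic_cycle3]
        isomorphic_trans[OF isomorphic_trans[OF isomorphic_swap3 isomorphic_cycle3] isomorphic_cycle3])
  then show ?thesis
    using isomorphic_conj3[of s a] isomorphic_trans[of _ "TP (xi3 s)"] unfolding t'
      by (elim disjE) simp_all
qed

definition seventeen3 :: "letter \<Rightarrow> letter \<Rightarrow> letter \<Rightarrow> triple list" where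
  "seventeen3 x y z =
    [(Rot, Rot, Rot), (Rot, Rot, Id3), (Rot, Id3, Id3), (Rot, Rot, Rot'), (Rot, Rot', Id3),
     (Refl x, Refl y, Refl z), (Refl x, Refl y, Id3), (Refl x, Rot, Id3),
     (Refl x, Refl y, Rot), (Refl x, Refl y, Rot'),
     (Refl x, Refl x, Refl y), (Refl x, Refl x, Rot), (Rot, Rot, Refl z),
     (Rot, Rot', Refl z),
     (Refl x, Refl x, Refl x), (Id3, Id3, Refl x), (Id3, Id3, Id3)]"

lemma xi_of_seventeen: "map xi_of (seventeen x y z) = map xi3 (seventeen3 x y z)"
  by (simp add: seventeen_def seventeen3_def fn_simps)

text \<open>The extra triple represents the eighteenth orbit.\<close>

lemma orbit3_meets:
  "\<forall>f \<in> set perm3s. \<forall>g \<in> set perm3s. \<forall>h \<in> set perm3s. \<exists>t \<in> set (orbit3 (f, g, h)).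
     t \<in> set ((Id3, Refl La, Refl La) # seventeen3 La Lb Lc)"
  by code_simp

text \<open>Membership rather than equal positions: an odd permutation of the letters turns rho into
  its inverse, so (sigma_x, sigma_y, rho) and (sigma_x, sigma_y, rho^{-1}) trade places. Only the
  lists as wholes correspond.\<close>

definition permute_letters :: "letter \<Rightarrow> letter \<Rightarrow> letter \<Rightarrow> bool" where
  "permute_letters x y z \<longleftrightarrow>
     (\<forall>t \<in> set ((Id3, Refl La, Refl La) # seventeen3 La Lb Lc). \<exists>t' \<in> set (orbit3 t).
        t' \<in> set ((Id3, Refl x, Refl x) # seventeen3 x y z))"

lemma permute_letters:
  "permute_letters La Lb Lc" "permute_letters La Lc Lb" "permute_letters Lb La Lc"
  "permute_letters Lb Lc La" "permute_letters Lc La Lb" "permute_letters Lc Lb La"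
  by code_simp+

lemma distinct_letters_cases:
  assumes "{x, y, z} = {La, Lb, Lc}"
  shows "(x, y, z) \<in> {(La, Lb, Lc), (La, Lc, Lb), (Lb, La, Lc), (Lb, Lc, La), (Lc, La, Lb), (Lc, Lb,
    La)}"
  using assms by (cases x; cases y; cases z; auto)

section \<open>An exceptional isomorphism\<close>

text \<open>Both systems below also contain the graph $K_5$ on $a_1$, $q^b$, $q^c$, $a_2$, $a_3$; the map
  exchanges it with \<open>free_vertices 1\<close>.\<close>

definition exchange :: "tp_point \<Rightarrow> tp_point" where
  "exchange p =
    (if p = Apex Lb then Vertex Lb 1 else if p = Apex Lc then Vertex Lc 1
     else if p = Vertex Lb 1 then Apex Lb else if p = Vertex Lc 1 then Apex Lc
     else if p = Vertex Lb 2 then Vertex Lc 2 else if p = Vertex Lc 2 then Vertex Lb 2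
     else if p = Vertex La 2 then Centre {1, 2} else if p = Vertex La 3 then Centre {1, 3}
     else if p = Centre {1, 2} then Vertex La 2 else if p = Centre {1, 3} then Vertex La 3
     else p)"

lemma exchange_simps:
  "map exchange point_list =
     [Apex La, Vertex Lb 1, Vertex Lc 1, Vertex La 1, Apex Lb, Apex Lc, Centre {1, 2}, Vertex Lc 2,
       Vertex Lb 2,
      Centre {1, 3}, Vertex Lb 3, Vertex Lc 3, Vertex La 2, Vertex La 3, Centre {2, 3}]"
  by (simp add: point_list_def exchange_def doubleton_eq_iff)

text \<open>Not a relabelling of letters and indices: the line of the apices becomes a side, and the
  axis becomes a perspective line.\<close>

lemma isomorphic_exchange:
  "isomorphic (TP (xi3 (Id3, Refl La, Refl La))) (TP (xi3 (Id3, Id3, Refl La)))"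
proof (rule isomorphicI[OF configuration_TP[OF perspective_system_xi3]
  configuration_TP[OF perspective_system_xi3]])
  let ?\<xi> = "xi3 (Id3, Refl La, Refl La)" and ?\<xi>' = "xi3 (Id3, Id3, Refl La)"
  have "distinct (map exchange point_list)" "set (map exchange point_list) \<subseteq> set point_list"
    unfolding exchange_simps by (simp_all add: doubleton_eq_iff point_list_def)
  then show "inj_on exchange (points (TP ?\<xi>))" "exchange ` points (TP ?\<xi>) \<subseteq> points (TP ?\<xi>')"
    unfolding points_TP_list by (simp_all add: distinct_map)
  note [simp] = exchange_simps[unfolded point_list_def, simplified]
  have range_Apex: "range Apex = {Apex La, Apex Lb, Apex Lc}" by (simp add: UNIV_letter)
  note sets = range_Apex axis_def side_def Compl_letter ray_def xi_of_def insert_commute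
  have base: "exchange ` range Apex = side La 1" "exchange ` axis = ray ?\<xi>' 2 3 La"
    by (simp_all add: sets)
  have sides: "exchange ` side La 1 = range Apex" "exchange ` side Lb 1 = side Lc 1"
    "exchange ` side Lc 1 = side Lb 1"
    "exchange ` side La 2 = side La 2" "exchange ` side Lb 2 = ray ?\<xi>' 1 2 Lb"
      "exchange ` side Lc 2 = ray ?\<xi>' 1 2 Lc"
    "exchange ` side La 3 = side La 3" "exchange ` side Lb 3 = ray ?\<xi>' 1 3 Lb"
      "exchange ` side Lc 3 = ray ?\<xi>' 1 3 Lc"
    by (simp_all add: sets)
  have rays: "exchange ` ray ?\<xi> 1 2 La = ray ?\<xi>' 1 2 La" "exchange ` ray ?\<xi> 1 2 Lb = side Lb 2"
    "exchange ` ray ?\<xi> 1 2 Lc = side Lc 2" "exchange ` ray ?\<xi> 2 3 La = axis"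
    "exchange ` ray ?\<xi> 2 3 Lb = ray ?\<xi>' 2 3 Lc" "exchange ` ray ?\<xi> 2 3 Lc = ray ?\<xi>' 2 3 Lb"
    "exchange ` ray ?\<xi> 1 3 La = ray ?\<xi>' 1 3 La" "exchange ` ray ?\<xi> 1 3 Lb = side Lb 3"
    "exchange ` ray ?\<xi> 1 3 Lc = side Lc 3"
    by (simp_all add: sets)
  have side: "side u i \<in> lines (TP ?\<xi>')" if "i \<in> {1, 2, 3}" for u i
    using that unfolding lines_TP idx_def by blast
  have ray: "ray ?\<xi>' i j u \<in> lines (TP ?\<xi>')" if "i \<in> idx" "j \<in> idx" "i \<noteq> j" for i j u
    using that unfolding lines_TP by blast
  have rays': "ray ?\<xi>' 1 2 u \<in> lines (TP ?\<xi>')" "ray ?\<xi>' 2 3 u \<in> lines (TP ?\<xi>')"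
    "ray ?\<xi>' 1 3 u \<in> lines (TP ?\<xi>')" for u
    by (rule ray; simp add: idx_def)+
  have "range Apex \<in> lines (TP ?\<xi>')" "axis \<in> lines (TP ?\<xi>')" unfolding lines_TP by blast+
  note target = side rays' this
  fix l assume "l \<in> lines (TP ?\<xi>)"
  then consider "l = range Apex" | "l = axis" | u i where "i \<in> idx" "l = side u i"
    | i j u where "i \<in> idx" "j \<in> idx" "i \<noteq> j" "l = ray ?\<xi> i j u"
    unfolding lines_TP by blast
  then show "exchange ` l \<in> lines (TP ?\<xi>')"
  proof cases
    case 1
    then show ?thesis by (simp only: base target insert_iff simp_thms)
  next
    case 2
    then show ?thesis by (simp only: base target)
  next
    case (3 u i)
    then show ?thesis
      unfolding idx_def by (cases u; elim insertE emptyE; simp only: sides target insert_iff simp_thms)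
  next
    case (4 i j u)
    have *: "exchange ` ray ?\<xi> 1 2 u \<in> lines (TP ?\<xi>')" "exchange ` ray ?\<xi> 2 3 u \<in> lines (TP ?\<xi>')"
      "exchange ` ray ?\<xi> 1 3 u \<in> lines (TP ?\<xi>')" for u
      by (cases u; simp only: rays target insert_iff simp_thms)+
    \<comment> \<open>The table \<open>rays\<close> reads each perspective line from its smaller
      index; the remaining descriptions are turned round.\<close>
    have l': "l = ray ?\<xi> j i (?\<xi> i j u)"
      unfolding 4(4) by (rule ray_commute[OF perspective_system_xi3 4(1,2), symmetric])
    have "i = 1 \<and> j = 2 \<or> i = 2 \<and> j = 3 \<or> i = 1 \<and> j = 3 \<or> j = 1 \<and> i = 2 \<or> j = 2 \<and> i = 3 \<or> j = 1 \<and> i = 3"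
      using 4(1-3) unfolding idx_def by (elim insertE emptyE) simp_all
    then consider "i = 1 \<and> j = 2 \<or> i = 2 \<and> j = 3 \<or> i = 1 \<and> j = 3"
      | "j = 1 \<and> i = 2 \<or> j = 2 \<and> i = 3 \<or> j = 1 \<and> i = 3" by argo
    then show ?thesis
    proof cases
      case 1
      then show ?thesis unfolding 4(4) by (elim disjE conjE) (simp_all only: *)
    next
      case 2
      then show ?thesis unfolding l' by (elim disjE conjE) (simp_all only: *)
    qed
  qed
qed

section \<open>An invariant\<close>

definition non_collinear :: "'p incidence \<Rightarrow> 'p \<Rightarrow> 'p set" where
  "non_collinear K p = {q \<in> points K. \<not> (\<exists>l \<in> lines K. p \<in> l \<and> q \<in> l)}"

text \<open>Counts every triangle of the non-collinearity graph through \<open>p\<close> twice. The multiset of these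
  counts alone does not separate the seventeen systems.\<close>

definition triangles :: "'p incidence \<Rightarrow> 'p \<Rightarrow> nat" where
  "triangles K p = (\<Sum>q \<in> non_collinear K p. card (non_collinear K p \<inter> non_collinear K q))"

text \<open>In a (15_4 20_3)-configuration each point has 15 - 1 - 4 * 2 = 6 non-collinear points,
  so without the square the sum would be just six times the total of the triangle counts. The square
  records how these counts are distributed over neighbourhoods.\<close>

definition invariant :: "'p incidence \<Rightarrow> int" where
  "invariant K = (\<Sum>p \<in> points K. (\<Sum>q \<in> non_collinear K p. int (triangles K q))\<^sup>2)"

lemma non_collinear_subset: "non_collinear K p \<subseteq> points K"
  by (auto simp: non_collinear_def)

lemma invariant_isomorphic:
  assumes "isomorphic K M" and K: "\<forall>l \<in> lines K. l \<subseteq> points K"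
  shows "invariant K = invariant M"
proof -
  obtain f where f: "inj_on f (points K)" "f ` points K = points M" "(\<lambda>l. f ` l) ` lines K = lines M"
    using assms(1) unfolding isomorphic_def bij_betw_def by blast
  have nc: "non_collinear M (f p) = f ` non_collinear K p" if p: "p \<in> points K" for p
  proof -
    have "(\<exists>l \<in> lines M. f p \<in> l \<and> f q \<in> l) \<longleftrightarrow> (\<exists>l \<in> lines K. p \<in> l \<and> q \<in> l)" if q: "q \<in> points K" for q
      unfolding f(3)[symmetric] using K inj_on_image_mem_iff[OF f(1)] p q by simp
    then show ?thesis unfolding non_collinear_def f(2)[symmetric] by auto
  qed
  have inj: "inj_on f A" if "A \<subseteq> points K" for A using f(1) that by (rule inj_on_subset)
  have tri: "triangles M (f p) = triangles K p" if p: "p \<in> points K" for p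
  proof -
    have "triangles M (f p) = (\<Sum>q \<in> non_collinear K p. card (non_collinear M (f p) \<inter> non_collinear M
      (f q)))"
      unfolding triangles_def nc[OF p] by (subst sum.reindex) (simp_all add: inj non_collinear_subset)
    also have "\<dots> = triangles K p"
      unfolding triangles_def
    proof (rule sum.cong[OF refl])
      fix q assume "q \<in> non_collinear K p"
      then have q: "q \<in> points K" by (rule subsetD[OF non_collinear_subset])
      have "f ` (non_collinear K p \<inter> non_collinear K q) = non_collinear M (f p) \<inter> non_collinear M (f q)"
        unfolding nc[OF p] nc[OF q]
        by (rule inj_on_image_Int[OF f(1)]) (rule non_collinear_subset)+
      moreover have "card (f ` (non_collinear K p \<inter> non_collinear K q)) = card (non_collinear K p \<inter>
        non_collinear K q)"
        by (intro card_image inj le_infI1 non_collinear_subset)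
      ultimately show "card (non_collinear M (f p) \<inter> non_collinear M (f q)) =
        card (non_collinear K p \<inter> non_collinear K q)"
        by simp
    qed
    finally show ?thesis .
  qed
  have "(\<Sum>q \<in> non_collinear M (f p). int (triangles M q)) = (\<Sum>q \<in> non_collinear K p. int (triangles
    K q))"
    if p: "p \<in> points K" for p
    unfolding nc[OF p] using tri non_collinear_subset[of K p]
    by (subst sum.reindex) (auto simp: inj intro!: sum.cong)
  then show ?thesis
    unfolding invariant_def f(2)[symmetric] using f(1) by (subst sum.reindex) (auto intro!: sum.cong)
qed

section \<open>Evaluating the invariant on coded triples\<close>

fun entry3 :: "triple \<Rightarrow> nat \<Rightarrow> nat \<Rightarrow> perm3" where
  "entry3 (f, g, h) i j =
    (if i = 1 then (if j = 2 then f else if j = 3 then h else Id3)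
     else if i = 2 then (if j = 1 then perm3_inv f else if j = 3 then g else Id3)
     else if i = 3 then (if j = 1 then perm3_inv h else if j = 2 then perm3_inv g else Id3)
     else Id3)"

lemma xi3_entry3: "xi3 t i j = fn (entry3 t i j)"
  by (cases t) (simp add: xi_of_def inv_fn fn_simps(1))

text \<open>Non-collinearity in the system of a coded triple, for points with indices in \<open>idx\<close>.\<close>

fun apart :: "triple \<Rightarrow> tp_point \<Rightarrow> tp_point \<Rightarrow> bool" where
  "apart t (Apex u) (Vertex v i) \<longleftrightarrow> u = v"
| "apart t (Vertex v i) (Apex u) \<longleftrightarrow> u = v"
| "apart t (Apex u) (Centre e) \<longleftrightarrow> True"
| "apart t (Centre e) (Apex u) \<longleftrightarrow> True"
| "apart t (Centre e) (Vertex v i) \<longleftrightarrow> i \<notin> e"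
| "apart t (Vertex v i) (Centre e) \<longleftrightarrow> i \<notin> e"
| "apart t (Vertex u i) (Vertex v j) \<longleftrightarrow> i \<noteq> j \<and> fn (entry3 t i j) u \<noteq> v"
| "apart t (Apex u) (Apex v) \<longleftrightarrow> False"
| "apart t (Centre e) (Centre e') \<longleftrightarrow> False"

lemma bex_lines_TP:
  "(\<exists>l \<in> lines (TP \<xi>). P l) \<longleftrightarrow> P (range Apex) \<or> P axis \<or> (\<exists>i \<in> idx. \<exists>u. P (side u i)) \<or>
     (\<exists>i \<in> idx. \<exists>j \<in> idx. \<exists>u. i \<noteq> j \<and> P (ray \<xi> i j u))"
  unfolding lines_TP by (simp add: bex_Un) blast

lemma apart_iff:
  assumes "p \<in> points (TP (xi3 t))" "q \<in> points (TP (xi3 t))"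
  shows "apart t p q \<longleftrightarrow> \<not> (\<exists>l \<in> lines (TP (xi3 t)). p \<in> l \<and> q \<in> l)"
proof -
  let ?\<xi> = "xi3 t"
  note inverse = perspective_inverse[OF perspective_system_xi3[of t]]
  have VV: "(\<exists>l \<in> lines (TP ?\<xi>). Vertex u i \<in> l \<and> Vertex v j \<in> l) \<longleftrightarrow> i = j \<or> v = ?\<xi> i j u"
    if ij: "i \<in> idx" "j \<in> idx" for i j u v
  proof
    assume "\<exists>l \<in> lines (TP ?\<xi>). Vertex u i \<in> l \<and> Vertex v j \<in> l"
    then show "i = j \<or> v = ?\<xi> i j u"
      unfolding bex_lines_TP by (auto simp: mem_ray mem_axis inverse)
  next
    assume "i = j \<or> v = ?\<xi> i j u"
    moreover have "\<exists>l \<in> lines (TP ?\<xi>). Vertex u i \<in> l \<and> Vertex v j \<in> l" if "i = j"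
    proof -
      \<comment> \<open>The side opposite to a letter avoiding both contains both vertices; this
        includes the case \<open>u\<close> = \<open>v\<close>.\<close>
      obtain w where "w \<noteq> u" "w \<noteq> v" by (cases u; cases v; metis letter.distinct)
      then have "Vertex u i \<in> side w i" "Vertex v j \<in> side w i" using \<open>i = j\<close> by simp_all
      moreover have "side w i \<in> lines (TP ?\<xi>)" using ij unfolding lines_TP by blast
      ultimately show ?thesis by blast
    qed
    moreover have "\<exists>l \<in> lines (TP ?\<xi>). Vertex u i \<in> l \<and> Vertex v j \<in> l" if "v = ?\<xi> i j u" "i \<noteq> j"
    proof -
      have "Vertex u i \<in> ray ?\<xi> i j u" "Vertex v j \<in> ray ?\<xi> i j u" using that by (simp_all add: mem_ray)
      moreover have "ray ?\<xi> i j u \<in> lines (TP ?\<xi>)" using ij that unfolding lines_TP by blast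
      ultimately show ?thesis by blast
    qed
    ultimately show "\<exists>l \<in> lines (TP ?\<xi>). Vertex u i \<in> l \<and> Vertex v j \<in> l" by blast
  qed
  have AV: "(\<exists>l \<in> lines (TP ?\<xi>). Apex u \<in> l \<and> Vertex v i \<in> l) \<longleftrightarrow> u \<noteq> v"
    if "i \<in> idx" for i u v
    unfolding bex_lines_TP using that by (auto simp: mem_ray mem_axis)
  have CV: "(\<exists>l \<in> lines (TP ?\<xi>). Centre {i, j} \<in> l \<and> Vertex v k \<in> l) \<longleftrightarrow> k \<in> {i, j}"
    if ij: "i \<in> idx" "j \<in> idx" "k \<in> idx" "i \<noteq> j" for i j k v
  proof
    assume "\<exists>l \<in> lines (TP ?\<xi>). Centre {i, j} \<in> l \<and> Vertex v k \<in> l"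
    then show "k \<in> {i, j}" unfolding bex_lines_TP by (auto simp: mem_ray mem_axis)
  next
    assume "k \<in> {i, j}"
    then have "ray ?\<xi> i j v \<in> lines (TP ?\<xi>) \<and> k = i \<or> ray ?\<xi> j i v \<in> lines (TP ?\<xi>) \<and> k = j"
      using ij unfolding lines_TP by blast
    then show "\<exists>l \<in> lines (TP ?\<xi>). Centre {i, j} \<in> l \<and> Vertex v k \<in> l"
      by (metis mem_ray(2,3) insert_commute)
  qed
  have AA: "\<exists>l \<in> lines (TP ?\<xi>). Apex u \<in> l \<and> Apex v \<in> l" for u v
    unfolding bex_lines_TP by blast
  have CC: "\<exists>l \<in> lines (TP ?\<xi>). Centre {i, j} \<in> l \<and> Centre {i', j'} \<in> l"
    if "i \<in> idx" "j \<in> idx" "i \<noteq> j" "i' \<in> idx" "j' \<in> idx" "i' \<noteq> j'" for i j i' j'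
    unfolding bex_lines_TP using mem_axis(3) that by blast
  have AC: "\<not> (\<exists>l \<in> lines (TP ?\<xi>). Apex u \<in> l \<and> Centre e \<in> l)" for u e
    unfolding bex_lines_TP by (auto simp: mem_ray mem_axis)
  define R where "R p q \<longleftrightarrow> (\<exists>l \<in> lines (TP ?\<xi>). p \<in> l \<and> q \<in> l)" for p q
  \<comment> \<open>The preceding facts treat each pair of different kinds of points in one order
    only.\<close>
  have sym: "R p q = R q p" for p q by (auto simp: R_def)
  note rules = VV AV CV AA CC AC
  note rules = rules[folded R_def]
  note rules = rules sym[of "Vertex _ _" "Apex _"] sym[of "Vertex _ _" "Centre _"] sym[of "Centre _"
    "Apex _"]
  have "apart t p q \<longleftrightarrow> \<not> R p q"
    using assms unfolding points_TP by (auto simp: rules xi3_entry3[symmetric])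
  then show ?thesis by (simp add: R_def)
qed

lemma non_collinear_TP:
  assumes "p \<in> points (TP (xi3 t))"
  shows "non_collinear (TP (xi3 t)) p = set (filter (apart t p) point_list)"
  using apart_iff[OF assms] unfolding non_collinear_def points_TP_list by auto

definition apart_list :: "triple \<Rightarrow> tp_point \<Rightarrow> tp_point list" where
  "apart_list t p = filter (apart t p) point_list"

definition triangle_count :: "triple \<Rightarrow> tp_point \<Rightarrow> nat" where
  "triangle_count t p =
     (let n = apart_list t p in sum_list (map (\<lambda>q. length (filter (apart t q) n)) n))"

definition invariant3 :: "triple \<Rightarrow> int" where
  "invariant3 t =
     (let ts = map (\<lambda>p. (p, int (triangle_count t p))) point_list
      in sum_list (map (\<lambda>p. (sum_list (map snd (filter (\<lambda>(q, _). apart t p q) ts)))\<^sup>2) point_list))"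

lemma triangles_TP:
  assumes p: "p \<in> points (TP (xi3 t))"
  shows "triangles (TP (xi3 t)) p = triangle_count t p"
proof -
  have dist: "distinct (apart_list t p)" by (simp add: apart_list_def distinct_point_list)
  have "card (non_collinear (TP (xi3 t)) p \<inter> non_collinear (TP (xi3 t)) q) =
    length (filter (apart t q) (apart_list t p))"
    if "q \<in> set (apart_list t p)" for q
  proof -
    have q: "q \<in> points (TP (xi3 t))" using that by (simp add: apart_list_def points_TP_list)
    have "non_collinear (TP (xi3 t)) p \<inter> non_collinear (TP (xi3 t)) q =
      set (filter (apart t q) (apart_list t p))"
      unfolding non_collinear_TP[OF p] non_collinear_TP[OF q] by (auto simp: apart_list_def)
    then show ?thesis by (simp only: distinct_card[OF distinct_filter[OF dist]])
  qed
  then show ?thesis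
    unfolding triangles_def triangle_count_def Let_def non_collinear_TP[OF p] apart_list_def[symmetric]
    using dist by (simp add: sum_list_distinct_conv_sum_set)
qed

text \<open>Since \<open>point_list\<close> is free of repetitions, sums over sets become sums over
  lists, which can be evaluated.\<close>

lemma invariant_TP: "invariant (TP (xi3 t)) = invariant3 t"
proof -
  have "(\<Sum>q \<in> non_collinear (TP (xi3 t)) p. int (triangles (TP (xi3 t)) q)) =
      sum_list (map snd (filter (\<lambda>(q, _). apart t p q) (map (\<lambda>p. (p, int (triangle_count t p)))
        point_list)))"
    if p: "p \<in> points (TP (xi3 t))" for p
  proof -
    have "(\<Sum>q \<in> non_collinear (TP (xi3 t)) p. int (triangles (TP (xi3 t)) q)) =
       (\<Sum>q \<in> set (apart_list t p). int (triangle_count t q))"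
      unfolding non_collinear_TP[OF p] apart_list_def[symmetric]
      by (rule sum.cong[OF refl]) (simp add: triangles_TP points_TP_list apart_list_def)
    also have "\<dots> = sum_list (map (\<lambda>q. int (triangle_count t q)) (apart_list t p))"
      by (simp add: sum_list_distinct_conv_sum_set apart_list_def distinct_point_list)
    finally show ?thesis by (simp add: apart_list_def filter_map o_def)
  qed
  then show ?thesis
    unfolding invariant_def invariant3_def Let_def points_TP_list
    by (simp add: sum_list_distinct_conv_sum_set distinct_point_list)
qed

lemma distinct_invariant3:
  "distinct (map invariant3 (seventeen3 La Lb Lc))" "distinct (map invariant3 (seventeen3 La Lc Lb))"
  "distinct (map invariant3 (seventeen3 Lb La Lc))" "distinct (map invariant3 (seventeen3 Lb Lc La))"
  "distinct (map invariant3 (seventeen3 Lc La Lb))" "distinct (map invariant3 (seventeen3 Lc Lb La))"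
  by code_simp+

section \<open>Assembling the classification\<close>

lemma TP_eq_xi3:
  assumes \<xi>: "perspective_system \<xi>"
  shows "\<exists>t. TP \<xi> = TP (xi3 t)"
proof -
  obtain f g h where fgh: "\<xi> 1 2 = fn f" "\<xi> 2 3 = fn g" "\<xi> 1 3 = fn h"
    using bij_letter[OF bij_perspective[OF \<xi>]] by (metis idx_def insertCI)
  \<comment> \<open>\<open>TP\<close> reads \<open>\<xi>\<close> only at indices in
    \<open>idx\<close>, so the coded system yields an equal structure, not merely an isomorphic
    one.\<close>
  have "ray \<xi> i j u = ray (xi3 (f, g, h)) i j u" if "i \<in> idx" "j \<in> idx" for i j u
    using xi_of_unique[OF \<xi> that] unfolding fgh by (simp add: ray_def)
  then have "lines (TP \<xi>) = lines (TP (xi3 (f, g, h)))"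
    unfolding lines_TP by (metis (no_types, lifting))
  moreover have "points (TP \<xi>) = points (TP (xi3 (f, g, h)))" by (simp add: points_TP)
  ultimately show ?thesis by (metis prod_eqI)
qed

text \<open>Carries \<open>isomorphic_exchange\<close>, proved for the reflection fixing a, over to
  any letter \<open>x\<close>.\<close>

lemma orbit3_Refl:
  "(Id3, Refl La, Refl La) \<in> set (orbit3 (Id3, Refl x, Refl x))"
  "(Id3, Id3, Refl x) \<in> set (orbit3 (Id3, Id3, Refl La))"
  by (cases x; hypsubst; code_simp)+

lemma isomorphic_seventeen3:
  assumes "{x, y, z} = {La, Lb, Lc}"
  shows "\<exists>t' \<in> set (seventeen3 x y z). isomorphic (TP (xi3 t)) (TP (xi3 t'))"
proof -
  obtain f g h where t: "t = (f, g, h)" by (cases t)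
  let ?S = "\<lambda>x y z. set ((Id3, Refl x, Refl x) # seventeen3 x y z)"
  obtain s where s: "s \<in> set (orbit3 t)" "s \<in> ?S La Lb Lc"
    using orbit3_meets[rule_format, OF set_perm3s[of f] set_perm3s[of g] set_perm3s[of h]]
      unfolding t by (elim bexE)
  have perm: "permute_letters x y z"
    using distinct_letters_cases[OF assms] permute_letters by auto
  then obtain r where r: "r \<in> set (orbit3 s)" "r \<in> ?S x y z"
    using perm[unfolded permute_letters_def, rule_format, OF s(2)] by (elim bexE)
  have iso: "isomorphic (TP (xi3 t)) (TP (xi3 r))"
    using isomorphic_trans[OF isomorphic_orbit3[OF s(1)] isomorphic_orbit3[OF r(1)]] .
  show ?thesis
  proof (cases "r = (Id3, Refl x, Refl x)")
    case True
    \<comment> \<open>In the eighteenth orbit, pass to the letter a, apply the exceptional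
      isomorphism and return to \<open>x\<close>.\<close>
    have "isomorphic (TP (xi3 r)) (TP (xi3 (Id3, Refl La, Refl La)))"
      unfolding True by (rule isomorphic_orbit3[OF orbit3_Refl(1)])
    from isomorphic_trans[OF iso isomorphic_trans[OF this isomorphic_exchange]]
    have "isomorphic (TP (xi3 t)) (TP (xi3 (Id3, Id3, Refl x)))"
      by (rule isomorphic_trans) (rule isomorphic_orbit3[OF orbit3_Refl(2)])
    moreover have "(Id3, Id3, Refl x) \<in> set (seventeen3 x y z)" by (simp add: seventeen3_def)
    ultimately show ?thesis by (rule bexI)
  next
    case False
    with r(2) have "r \<in> set (seventeen3 x y z)" unfolding list.set by (elim insertE) simp_all
    with iso show ?thesis by (rule bexI)
  qed
qed

theorem mainTheorem1:
  fixes x y z :: letter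
  assumes "{x, y, z} = {La, Lb, Lc}"
  shows "length (seventeen x y z) = 17 \<and>
    (\<forall>t \<in> set (seventeen x y z).
       configuration 15 4 20 3 (TP (xi_of t)) \<and> card (free_K5s (TP (xi_of t))) \<ge> 3) \<and>
    (\<forall>m < 17. \<forall>n < 17. m \<noteq> n \<longrightarrow>
       \<not> isomorphic (TP (xi_of (seventeen x y z ! m))) (TP (xi_of (seventeen x y z ! n)))) \<and>
    (\<forall>K :: 'p incidence. configuration 15 4 20 3 K \<and> card (free_K5s K) \<ge> 3 \<longrightarrow>
       (\<exists>t \<in> set (seventeen x y z). isomorphic K (TP (xi_of t))))"
proof (intro conjI ballI allI impI)
  show len: "length (seventeen x y z) = 17" by (simp add: seventeen_def)
  fix t assume "t \<in> set (seventeen x y z)"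
  then have "perspective_system (xi_of t)" by (rule perspective_system_seventeen)
  then show "configuration 15 4 20 3 (TP (xi_of t))" "card (free_K5s (TP (xi_of t))) \<ge> 3"
    by (rule configuration_TP, rule card_free_K5s_TP)
next
  fix m n :: nat assume mn: "m < 17" "n < 17" "m \<noteq> n"
  have len: "length (seventeen x y z) = 17" "length (seventeen3 x y z) = 17"
    by (simp_all add: seventeen_def seventeen3_def)
  have nth: "xi_of (seventeen x y z ! k) = xi3 (seventeen3 x y z ! k)" if "k < 17" for k
    using arg_cong[OF xi_of_seventeen[of x y z], of "\<lambda>xs. xs ! k"] that len by simp
  have "distinct (map invariant3 (seventeen3 x y z))"
    using distinct_letters_cases[OF assms] distinct_invariant3 by auto
  then have "invariant3 (seventeen3 x y z ! m) \<noteq> invariant3 (seventeen3 x y z ! n)"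
    using mn len by (simp add: distinct_conv_nth)
  then show "\<not> isomorphic (TP (xi_of (seventeen x y z ! m))) (TP (xi_of (seventeen x y z ! n)))"
    unfolding nth[OF mn(1)] nth[OF mn(2)] invariant_TP[symmetric]
    using invariant_isomorphic configuration_line_subset[OF configuration_TP[OF perspective_system_xi3]] by metis
next
  fix K :: "'p incidence"
  assume K: "configuration 15 4 20 3 K \<and> card (free_K5s K) \<ge> 3"
  \<comment> \<open>There may be more than three graphs; any three of them, numbered arbitrarily,
    serve.\<close>
  obtain Xs where Xs: "Xs \<subseteq> free_K5s K" "card Xs = 3" "finite Xs"
    using K obtain_subset_with_card_n by metis
  have "card idx = card Xs" "finite idx" using Xs by (simp_all add: idx_def)
  then obtain X where X: "bij_betw X idx Xs" using Xs(3) finite_same_card_bij by metis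
  interpret three_free_K5s K X
    using K X Xs(1) by unfold_locales (auto simp: bij_betw_def)
  obtain \<xi> where \<xi>: "perspective_system \<xi>" "isomorphic K (TP \<xi>)" using isomorphic_TP by blast
  obtain t where t: "TP \<xi> = TP (xi3 t)" using TP_eq_xi3[OF \<xi>(1)] by blast
  obtain t' where t': "t' \<in> set (seventeen3 x y z)" "isomorphic (TP (xi3 t)) (TP (xi3 t'))"
    using isomorphic_seventeen3[OF assms] by blast
  have iso: "isomorphic K (TP (xi3 t'))" by (rule isomorphic_trans[OF \<xi>(2)[unfolded t] t'(2)])
  have "xi3 t' \<in> set (map xi_of (seventeen x y z))"
    unfolding xi_of_seventeen using t'(1) by simp
  then obtain s where s: "s \<in> set (seventeen x y z)" "xi3 t' = xi_of s" unfolding set_map by (elim imageE)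
  show "\<exists>t \<in> set (seventeen x y z). isomorphic K (TP (xi_of t))"
    using iso s(1) unfolding s(2) by (rule bexI)
qed

end
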